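(* Let $d\ge 1$ and let $\mathcal K=(\mathcal K(n))_{n\ge1}$ be an open, bounded, circled matrix convex set in $\mathbb C^d$ containing a non-commutative neighborhood of $0$. Let $\Lambda\subset\mathcal F_d$ be a finite initial segment and let $p=\sum_{w\in\Lambda}p_w w$ with $p_w\in\mathbb C$. There exists $f=\sum_{w\in\mathcal F_d} f_w w\in\mathcal A(\mathcal K)^\infty$ such that $f_w=p_w$ for all $w\in\Lambda$ and $\|f\|\le 1$ if and only if $$\sup\{\|p(X)\| : X\in\mathcal K,\ X \text{ is } \Lambda\text{-nilpotent}\}\le 1.$$
   Context: $M_{m,n}$ denotes the complex $m\times n$ matrices, $M_n=M_{n,n}$, and $M_n(\mathbb C^d)$ the $d$-tuples $X=(X_1,\dots,X_d)$ with $X_j\in M_n$. A matrix convex set $\mathcal K=(\mathcal K(n))_{n\ge 1}$ is a sequence of sets $\mathcal K(n)\subset M_n(\mathbb C^d)$ such that (i) $X\in\mathcal K(n)$, $Y\in\mathcal K(m)$ imply $X\oplus Y=(X_1\oplus Y_1,\dots,X_d\oplus Y_d)\in\mathcal K(n+m)$; (ii) $X\in\mathcal K(m)$, $\alpha\in M_{m,n}$, $\alpha^*\alpha=I_n$ imply $\alpha^*X\alpha=(\alpha^*X_1\alpha,\dots,\alpha^*X_d\alpha)\in\mathcal K(n)$. $\mathcal K$ is open if each $\mathcal K(n)$ is open; circled if $e^{i\theta}\mathcal K(n)\subseteq\mathcal K(n)$ for all $\theta\in\mathbb R$ and all $n$. For $\gamma>0$ let $N_\gamma(n)=\{X\in M_n(\mathbb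 C^d):\sum_{j}X_jX_j^*<\gamma^2 I\}$; $\mathcal K$ contains a non-commutative neighborhood of $0$ if $N_\gamma(n)\subseteq\mathcal K(n)$ for all $n$ for some $\gamma>0$, and is bounded if $\mathcal K(n)\subseteq N_\Gamma(n)$ for all $n$ for some $\Gamma>0$. Write $X\in\mathcal K$ for $X\in\bigcup_n\mathcal K(n)$. $\mathcal F_d$ is the free semigroup of words in $g_1,\dots,g_d$ with identity the empty word $\emptyset$; $|w|$ is the length of $w$. For $w=g_{i_1}\cdots g_{i_k}$ and a $d$-tuple $T$ of operators, $T^w=T_{i_1}\cdots T_{i_k}$ and $T^\emptyset=I$. For a formal power series $f=\sum_{w\in\mathcal F_d}f_w w$ with $f_w\in\mathbb C$, $f(X)=\sum_{j=0}^\infty\sum_{|w|=j}f_wX^w$ when the sum over $j$ converges in norm. $\mathcal A(\mathcal K)^\infty$ is the set of such $f$ for which $f(X)$ converges for every $X\in\mathcal K$ and $\|f\|:=\sup\{\|f(X)\|:X\in\mathcal K\}<\infty$. A set $\Lambda\subset\mathcal F_d$ is an initial segment if for every $w\in\mathcal F_d\setminus\Lambda$ and $1\le j\le d$ both $g_jw$ and $wg_j$ lie in $\mathcal F_d\setminus\Lambda$. A tuple $X$ is $\Lambda$-nilpotent if $X^v=0$ for all $v\in\mathcal F_d\setminus\Lambda$. *)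

theory Defs
  imports
    "Jordan_Normal_Form.Schur_Decomposition"
    "HOL-Library.Extended_Real"
begin

text \<open>
  The letters \<open>g\<^sub>1, \<dots>, g\<^sub>d\<close> are the elements of a finite type \<open>'d\<close>, so \<open>d = CARD('d) \<ge> 1\<close> is
  arbitrary; words are lists over \<open>'d\<close>, and a \<open>d\<close>-tuple of matrices is a function on \<open>'d\<close>.
  Families indexed by matrix size have type \<open>nat \<Rightarrow> _\<close>, but only the levels \<open>n \<ge> 1\<close> are
  ever referred to.
\<close>

type_synonym 'd mtuple = "'d \<Rightarrow> complex mat"

type_synonym 'd nc_series = "'d list \<Rightarrow> complex"

definition mtuples :: "nat \<Rightarrow> 'd mtuple set" where
  "mtuples n = {X. \<forall>j. X j \<in> carrier_mat n n}"

definition l2_norm :: "complex vec \<Rightarrow> real" where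
  "l2_norm v = sqrt (\<Sum>i<dim_vec v. (cmod (v $ i))\<^sup>2)"

definition mat_norm :: "complex mat \<Rightarrow> real" where
  "mat_norm A = (SUP v\<in>{v \<in> carrier_vec (dim_col A). l2_norm v \<le> 1}. l2_norm (A *\<^sub>v v))"

text \<open>Sum of a finite family of \<open>n \<times> n\<close> matrices; matrices of all sizes share one type, so
  the class-based \<open>sum\<close> is available only for the entries.\<close>

definition mat_sum :: "nat \<Rightarrow> ('i \<Rightarrow> complex mat) \<Rightarrow> 'i set \<Rightarrow> complex mat" where
  "mat_sum n F A = mat n n (\<lambda>(i, j). \<Sum>a\<in>A. F a $$ (i, j))"

text \<open>The order on \<open>complex\<close> is that of \<open>HOL-Library.Complex_Order\<close>: \<open>0 < z\<close> says that \<open>z\<close> is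
  real and positive.\<close>

definition pos_def :: "nat \<Rightarrow> complex mat \<Rightarrow> bool" where
  "pos_def n A \<longleftrightarrow> (\<forall>v\<in>carrier_vec n. v \<noteq> 0\<^sub>v n \<longrightarrow> 0 < (A *\<^sub>v v) \<bullet>c v)"

definition nc_ball :: "real \<Rightarrow> nat \<Rightarrow> ('d::finite) mtuple set" where
  "nc_ball \<gamma> n = {X \<in> mtuples n.
     pos_def n (complex_of_real (\<gamma>\<^sup>2) \<cdot>\<^sub>m 1\<^sub>m n - mat_sum n (\<lambda>j. X j * mat_adjoint (X j)) UNIV)}"

definition direct_sum :: "'d mtuple \<Rightarrow> 'd mtuple \<Rightarrow> 'd mtuple" where
  "direct_sum X Y = (\<lambda>j. diag_block_mat [X j, Y j])"

definition matrix_convex :: "(nat \<Rightarrow> 'd mtuple set) \<Rightarrow> bool" where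
  "matrix_convex K \<longleftrightarrow>
     (\<forall>n\<ge>1. K n \<subseteq> mtuples n) \<and>
     (\<forall>n\<ge>1. \<forall>m\<ge>1. \<forall>X\<in>K n. \<forall>Y\<in>K m. direct_sum X Y \<in> K (n + m)) \<and>
     (\<forall>m\<ge>1. \<forall>n\<ge>1. \<forall>X\<in>K m. \<forall>\<alpha>\<in>carrier_mat m n.
        mat_adjoint \<alpha> * \<alpha> = 1\<^sub>m n \<longrightarrow> (\<lambda>j. mat_adjoint \<alpha> * X j * \<alpha>) \<in> K n)"

text \<open>Openness is with respect to the norm topology of the space of \<open>d\<close>-tuples.\<close>

definition mc_open :: "(nat \<Rightarrow> 'd mtuple set) \<Rightarrow> bool" where
  "mc_open K \<longleftrightarrow> (\<forall>n\<ge>1. \<forall>X\<in>K n. \<exists>\<epsilon>>0. \<forall>Y\<in>mtuples n.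
     (\<forall>j. mat_norm (Y j - X j) < \<epsilon>) \<longrightarrow> Y \<in> K n)"

definition mc_bounded :: "(nat \<Rightarrow> ('d::finite) mtuple set) \<Rightarrow> bool" where
  "mc_bounded K \<longleftrightarrow> (\<exists>\<Gamma>>0. \<forall>n\<ge>1. K n \<subseteq> nc_ball \<Gamma> n)"

definition circled :: "(nat \<Rightarrow> 'd mtuple set) \<Rightarrow> bool" where
  "circled K \<longleftrightarrow> (\<forall>\<theta>::real. \<forall>n\<ge>1. \<forall>X\<in>K n. (\<lambda>j. cis \<theta> \<cdot>\<^sub>m X j) \<in> K n)"

definition contains_nc_nbhd_0 :: "(nat \<Rightarrow> ('d::finite) mtuple set) \<Rightarrow> bool" where
  "contains_nc_nbhd_0 K \<longleftrightarrow> (\<exists>\<gamma>>0. \<forall>n\<ge>1. nc_ball \<gamma> n \<subseteq> K n)"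

primrec word_eval :: "nat \<Rightarrow> 'd mtuple \<Rightarrow> 'd list \<Rightarrow> complex mat" where
  "word_eval n X [] = 1\<^sub>m n"
| "word_eval n X (j # w) = X j * word_eval n X w"

definition poly_eval :: "nat \<Rightarrow> 'd list set \<Rightarrow> 'd nc_series \<Rightarrow> 'd mtuple \<Rightarrow> complex mat" where
  "poly_eval n \<Lambda> p X = mat_sum n (\<lambda>w. p w \<cdot>\<^sub>m word_eval n X w) \<Lambda>"

definition series_partial :: "nat \<Rightarrow> 'd nc_series \<Rightarrow> 'd mtuple \<Rightarrow> nat \<Rightarrow> complex mat" where
  "series_partial n f X N = mat_sum n (\<lambda>j. poly_eval n {w. length w = j} f X) {..<N}"

definition series_converges_to ::
    "nat \<Rightarrow> 'd nc_series \<Rightarrow> 'd mtuple \<Rightarrow> complex mat \<Rightarrow> bool" where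
  "series_converges_to n f X L \<longleftrightarrow>
     L \<in> carrier_mat n n \<and> (\<lambda>N. mat_norm (series_partial n f X N - L)) \<longlonglongrightarrow> 0"

definition series_eval :: "nat \<Rightarrow> 'd nc_series \<Rightarrow> 'd mtuple \<Rightarrow> complex mat" where
  "series_eval n f X = (THE L. series_converges_to n f X L)"

text \<open>The points of \<open>K\<close> are tagged with their size: \<open>(n, X)\<close> stands for \<open>X \<in> K n\<close>.\<close>

definition points :: "(nat \<Rightarrow> 'd mtuple set) \<Rightarrow> (nat \<times> 'd mtuple) set" where
  "points K = {(n, X). n \<ge> 1 \<and> X \<in> K n}"

definition series_norm :: "(nat \<Rightarrow> 'd mtuple set) \<Rightarrow> 'd nc_series \<Rightarrow> ereal" where
  "series_norm K f = (SUP (n, X)\<in>points K. ereal (mat_norm (series_eval n f X)))"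

definition A_infty :: "(nat \<Rightarrow> 'd mtuple set) \<Rightarrow> 'd nc_series set" where
  "A_infty K = {f. (\<forall>(n, X)\<in>points K. \<exists>L. series_converges_to n f X L) \<and> series_norm K f < \<infinity>}"

definition initial_segment :: "'d list set \<Rightarrow> bool" where
  "initial_segment \<Lambda> \<longleftrightarrow> (\<forall>w. w \<notin> \<Lambda> \<longrightarrow> (\<forall>j. j # w \<notin> \<Lambda> \<and> w @ [j] \<notin> \<Lambda>))"

definition nilpotent_wrt :: "nat \<Rightarrow> 'd list set \<Rightarrow> 'd mtuple \<Rightarrow> bool" where
  "nilpotent_wrt n \<Lambda> X \<longleftrightarrow> (\<forall>v. v \<notin> \<Lambda> \<longrightarrow> word_eval n X v = 0\<^sub>m n n)"

end

theory Submission
  imports Defs "HOL-Analysis.Convex_Euclidean_Space"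
begin

text \<open>
  Caratheodory--Fejer interpolation on a circled open matrix convex set. If \<open>f\<close> solves the problem, then
  \<open>f(X) = p(X)\<close> at every \<open>\<Lambda>\<close>-nilpotent \<open>X\<close>, because the words outside \<open>\<Lambda>\<close> contribute nothing; this
  gives the condition on \<open>p\<close>. The converse constructs the coefficients of \<open>f\<close> one word at a time and
  then proves that the resulting series is contractive on all of \<open>K\<close>.

  \<^emph>\<open>One more coefficient.\<close> Let \<open>w\<close> be a shortest word outside \<open>\<Lambda>\<close>. A coefficient \<open>c\<close> of \<open>w\<close> with
  \<open>\<parallel>p(X) + c X\<^sup>w\<parallel> \<le> 1\<close> for all points \<open>X\<close> that are nilpotent with respect to \<open>insert w \<Lambda>\<close> is needed.
  In terms of the functionals \<open>q \<mapsto> \<langle>q(X) x, y\<rangle>\<close> this asks that \<open>\<bar>a + c b\<bar> \<le> 1\<close> on the set of pairs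
  \<open>(a, b) = (\<langle>p(X) x, y\<rangle>, \<langle>X\<^sup>w x, y\<rangle>)\<close>. That set is convex since \<open>K\<close> is closed under direct sums, and it
  is invariant under scalars of modulus at most one since \<open>x\<close> can be rescaled; so by separation in
  \<open>\<complex>\<^sup>2\<close> such a \<open>c\<close> exists as soon as \<open>\<bar>a\<bar> \<le> 1\<close> whenever \<open>b = 0\<close>
  (\<open>circled_convex_separation\<close>). If \<open>\<langle>X\<^sup>w x, y\<rangle> = 0\<close>, then \<open>X\<close> can be compressed to a subspace on which
  the functional is unchanged and \<open>X\<^sup>w\<close> becomes zero; the compression is \<open>\<Lambda>\<close>-nilpotent and lies in \<open>K\<close>, and
  the assumption on \<open>p\<close> gives \<open>\<bar>a\<bar> \<le> 1\<close> (\<open>contractive_at_vanishing_moment\<close>). This replaces the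
  representation theorem for quotients of operator algebras by an elementary induction on the dimension.

  \<^emph>\<open>From nilpotent points to all points.\<close> Iteration gives a series \<open>f\<close> that extends \<open>p\<close> and is contractive
  at all nilpotent points (\<open>contractive_extension\<close>). If \<open>X \<in> K\<close> and \<open>S\<close> is a finite nilpotent
  shift, then \<open>X \<otimes> S\<close> is a nilpotent point of \<open>K\<close> because \<open>K\<close> is circled (\<open>shift_tuple_mem\<close>), and \<open>f(X \<otimes> S)\<close>
  is a block Toeplitz matrix formed from the homogeneous parts of \<open>f\<close> at \<open>X\<close>. Its contractivity bounds
  the homogeneous parts and the arithmetic means of the partial sums (\<open>toeplitz_contractive\<close>). As \<open>K\<close> is
  open, the first bound also holds at \<open>(1 + \<delta>) X\<close>, whence \<open>f(X)\<close> converges; the second one passes to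
  the limit and gives \<open>\<parallel>f(X)\<parallel> \<le> 1\<close> (\<open>contractive_series_converges\<close>).
\<close>

(* Vectors and matrices carry their dimensions as numbers here, not as index types. *)
unbundle no vec_syntax
hide_type (open) Finite_Cartesian_Product.vec
hide_const (open) Finite_Cartesian_Product.row Finite_Cartesian_Product.mat
  Finite_Cartesian_Product.vec

section \<open>Sesquilinear forms and the operator norm\<close>

lemma mat_adjoint_carrier [simp]: "A \<in> carrier_mat n m \<Longrightarrow> mat_adjoint A \<in> carrier_mat m n"
  unfolding mat_adjoint_def by (rule carrier_matI) simp_all

lemma mat_adjoint_dim [simp]: "dim_row (mat_adjoint A) = dim_col A" "dim_col (mat_adjoint A) = dim_row A"
  by (simp_all add: mat_adjoint_def)

lemma mat_adjoint_index:
  assumes "A \<in> carrier_mat n m" "i < m" "j < n"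
  shows "mat_adjoint A $$ (i, j) = cnj (A $$ (j, i))"
  unfolding mat_adjoint_def using assms by (subst mat_of_rows_index) simp_all

lemma cscalar_sum: "v \<bullet>c w = (\<Sum>i<dim_vec w. v $ i * cnj (w $ i))"
  unfolding scalar_prod_def atLeast0LessThan by simp

lemma cscalar_sum_carrier:
  "w \<in> carrier_vec n \<Longrightarrow> v \<bullet>c w = (\<Sum>i<n. v $ i * cnj (w $ i))"
  by (auto simp: cscalar_sum)

lemma mult_mat_vec_index_sum:
  fixes A :: "complex mat"
  assumes "A \<in> carrier_mat n m" "v \<in> carrier_vec m" "i < n"
  shows "(A *\<^sub>v v) $ i = (\<Sum>k<m. A $$ (i, k) * v $ k)"
proof -
  have "(A *\<^sub>v v) $ i = (\<Sum>k<m. row A i $ k * v $ k)"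
    using assms unfolding mult_mat_vec_def scalar_prod_def atLeast0LessThan by simp
  also have "\<dots> = (\<Sum>k<m. A $$ (i, k) * v $ k)"
    using assms by (intro sum.cong) auto
  finally show ?thesis .
qed

lemma cscalar_mult_mat_vec:
  fixes A :: "complex mat"
  assumes A: "A \<in> carrier_mat n m" and x: "x \<in> carrier_vec m" and y: "y \<in> carrier_vec n"
  shows "(A *\<^sub>v x) \<bullet>c y = x \<bullet>c (mat_adjoint A *\<^sub>v y)"
proof -
  have "(A *\<^sub>v x) \<bullet>c y = (\<Sum>i<n. \<Sum>k<m. A $$ (i, k) * x $ k * cnj (y $ i))"
    unfolding cscalar_sum_carrier[OF y]
    by (intro sum.cong refl) (simp add: mult_mat_vec_index_sum[OF A x] sum_distrib_right
        del: index_mult_mat_vec)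
  also have "\<dots> = (\<Sum>k<m. \<Sum>i<n. A $$ (i, k) * x $ k * cnj (y $ i))"
    by (rule sum.swap)
  also have "\<dots> = (\<Sum>k<m. x $ k * cnj (\<Sum>i<n. mat_adjoint A $$ (k, i) * y $ i))"
    unfolding cnj_sum sum_distrib_left
    by (intro sum.cong refl) (simp add: mat_adjoint_index[OF A])
  also have "\<dots> = (\<Sum>k<m. x $ k * cnj ((mat_adjoint A *\<^sub>v y) $ k))"
    by (intro sum.cong refl)
      (simp add: mult_mat_vec_index_sum[OF mat_adjoint_carrier[OF A] y] del: index_mult_mat_vec)
  also have "\<dots> = x \<bullet>c (mat_adjoint A *\<^sub>v y)"
    by (rule cscalar_sum_carrier[symmetric, OF mult_mat_vec_carrier[OF mat_adjoint_carrier[OF A] y]])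
  finally show ?thesis .
qed

lemma l2_norm_L2_set: "l2_norm v = L2_set (\<lambda>i. cmod (v $ i)) {..<dim_vec v}"
  by (simp add: l2_norm_def L2_set_def)

lemma l2_norm_nonneg [simp]: "0 \<le> l2_norm v"
  by (simp add: l2_norm_def sum_nonneg)

lemma cscalar_self: "v \<bullet>c v = complex_of_real ((l2_norm v)\<^sup>2)"
  by (simp add: cscalar_sum l2_norm_def sum_nonneg complex_norm_square del: of_real_power)

lemma cauchy_schwarz_cscalar:
  assumes "v \<in> carrier_vec n" "w \<in> carrier_vec n"
  shows "cmod (v \<bullet>c w) \<le> l2_norm v * l2_norm w"
proof -
  have "cmod (v \<bullet>c w) \<le> (\<Sum>i<n. \<bar>cmod (v $ i)\<bar> * \<bar>cmod (w $ i)\<bar>)"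
    using assms by (auto simp: cscalar_sum intro!: sum_norm_le simp: norm_mult)
  also have "\<dots> \<le> L2_set (\<lambda>i. cmod (v $ i)) {..<n} * L2_set (\<lambda>i. cmod (w $ i)) {..<n}"
    by (rule L2_set_mult_ineq)
  finally show ?thesis using assms by (simp add: l2_norm_L2_set)
qed

lemma l2_norm_smult: "l2_norm (c \<cdot>\<^sub>v v) = cmod c * l2_norm v"
proof -
  have "l2_norm (c \<cdot>\<^sub>v v) = L2_set (\<lambda>i. cmod c * cmod (v $ i)) {..<dim_vec v}"
    unfolding l2_norm_L2_set by (intro L2_set_cong) (auto simp: norm_mult)
  thus ?thesis by (simp add: l2_norm_L2_set L2_set_right_distrib)
qed

lemma l2_norm_zero [simp]: "l2_norm (0\<^sub>v n) = 0"
  by (simp add: l2_norm_def)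

lemma l2_norm_unit_vec [simp]: "i < n \<Longrightarrow> l2_norm (unit_vec n i) = 1"
proof -
  assume i: "i < n"
  have "(\<Sum>k<n. (cmod (unit_vec n i $ k))\<^sup>2) = (\<Sum>k<n. if k = i then 1 else 0)"
    using i by (intro sum.cong) auto
  thus ?thesis using i by (simp add: l2_norm_def)
qed

lemma cscalar_unit_vec: "i < n \<Longrightarrow> (v :: complex vec) \<in> carrier_vec n \<Longrightarrow> v \<bullet>c unit_vec n i = v $ i"
proof -
  assume i: "i < n" and v: "v \<in> carrier_vec n"
  have "v \<bullet>c unit_vec n i = (\<Sum>k<n. if k = i then v $ k else 0)"
    unfolding cscalar_sum_carrier[OF unit_vec_carrier] using i by (intro sum.cong refl) simp
  thus ?thesis using i by simp
qed

lemma l2_norm_mult_le: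
  assumes A: "A \<in> carrier_mat n m" and v: "v \<in> carrier_vec m"
  shows "l2_norm (A *\<^sub>v v) \<le> (\<Sum>i<n. \<Sum>k<m. cmod (A $$ (i, k))) * l2_norm v"
proof -
  have "l2_norm (A *\<^sub>v v) \<le> (\<Sum>i<n. cmod ((A *\<^sub>v v) $ i))"
    using A by (simp add: l2_norm_L2_set L2_set_le_sum del: index_mult_mat_vec)
  also have "\<dots> \<le> (\<Sum>i<n. (\<Sum>k<m. cmod (A $$ (i, k))) * l2_norm v)"
  proof (rule sum_mono)
    fix i assume i: "i \<in> {..<n}"
    have "cmod ((A *\<^sub>v v) $ i) \<le> (\<Sum>k<m. cmod (A $$ (i, k)) * cmod (v $ k))"
      using A v i by (auto simp: mult_mat_vec_index_sum norm_mult simp del: index_mult_mat_vec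
          intro!: sum_norm_le)
    also have "\<dots> \<le> (\<Sum>k<m. cmod (A $$ (i, k)) * l2_norm v)"
      using v by (auto intro!: sum_mono mult_left_mono member_le_L2_set simp: l2_norm_L2_set)
    finally show "cmod ((A *\<^sub>v v) $ i) \<le> (\<Sum>k<m. cmod (A $$ (i, k))) * l2_norm v"
      by (simp add: sum_distrib_right)
  qed
  finally show ?thesis by (simp add: sum_distrib_right)
qed

lemma mat_norm_bdd:
  assumes A: "A \<in> carrier_mat n m"
  shows "bdd_above ((\<lambda>v. l2_norm (A *\<^sub>v v)) ` {v \<in> carrier_vec (dim_col A). l2_norm v \<le> 1})"
proof (rule bdd_aboveI2)
  fix v assume "v \<in> {v \<in> carrier_vec (dim_col A). l2_norm v \<le> 1}"
  hence v: "v \<in> carrier_vec m" "l2_norm v \<le> 1" using A by auto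
  have "l2_norm (A *\<^sub>v v) \<le> (\<Sum>i<n. \<Sum>k<m. cmod (A $$ (i, k))) * l2_norm v"
    by (rule l2_norm_mult_le[OF A v(1)])
  also have "\<dots> \<le> (\<Sum>i<n. \<Sum>k<m. cmod (A $$ (i, k))) * 1"
    using v by (intro mult_left_mono sum_nonneg) auto
  finally show "l2_norm (A *\<^sub>v v) \<le> (\<Sum>i<n. \<Sum>k<m. cmod (A $$ (i, k)))" by simp
qed

lemma form_le_mat_norm:
  assumes A: "A \<in> carrier_mat n m"
    and x: "x \<in> carrier_vec m" "l2_norm x \<le> 1" and y: "y \<in> carrier_vec n" "l2_norm y \<le> 1"
  shows "cmod ((A *\<^sub>v x) \<bullet>c y) \<le> mat_norm A"
proof -
  have "cmod ((A *\<^sub>v x) \<bullet>c y) \<le> l2_norm (A *\<^sub>v x) * l2_norm y"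
    using A x y by (intro cauchy_schwarz_cscalar[of _ n]) auto
  also have "\<dots> \<le> l2_norm (A *\<^sub>v x) * 1" using y by (intro mult_left_mono) auto
  also have "\<dots> \<le> mat_norm A"
    unfolding mat_norm_def using A x cSUP_upper[OF _ mat_norm_bdd[OF A], of x] by auto
  finally show ?thesis .
qed

text \<open>
  A bound on the numbers \<open>(A *\<^sub>v x) \<bullet>c y\<close> is linear in \<open>A\<close>, which is why norms are tested in
  this way throughout; the normalised vector \<open>A *\<^sub>v x\<close> is the optimal \<open>y\<close>.
\<close>

lemma mat_norm_le:
  assumes A: "A \<in> carrier_mat n m" and c: "0 \<le> c"
    and le: "\<And>x y. x \<in> carrier_vec m \<Longrightarrow> l2_norm x \<le> 1 \<Longrightarrow> y \<in> carrier_vec n \<Longrightarrow>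
      l2_norm y \<le> 1 \<Longrightarrow> cmod ((A *\<^sub>v x) \<bullet>c y) \<le> c"
  shows "mat_norm A \<le> c"
  unfolding mat_norm_def
proof (rule cSUP_least)
  show "{v \<in> carrier_vec (dim_col A). l2_norm v \<le> 1} \<noteq> {}"
    by (auto intro!: exI[of _ "0\<^sub>v (dim_col A)"])
  fix x assume "x \<in> {v \<in> carrier_vec (dim_col A). l2_norm v \<le> 1}"
  hence x: "x \<in> carrier_vec m" "l2_norm x \<le> 1" using A by auto
  define u where "u = A *\<^sub>v x"
  have u: "u \<in> carrier_vec n" using A x by (simp add: u_def)
  show "l2_norm (A *\<^sub>v x) \<le> c"
  proof (cases "l2_norm u = 0")
    case True thus ?thesis using c by (simp add: u_def)
  next
    case False
    define y where "y = complex_of_real (1 / l2_norm u) \<cdot>\<^sub>v u"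
    have y: "y \<in> carrier_vec n" "l2_norm y \<le> 1"
      using u False by (auto simp: y_def l2_norm_smult norm_divide)
    have "u \<bullet>c y = complex_of_real (1 / l2_norm u) * (u \<bullet>c u)"
      using u y(1) by (auto simp: cscalar_sum_carrier[of _ n] sum_distrib_left y_def intro!: sum.cong)
    also have "\<dots> = complex_of_real (l2_norm u)"
      using False by (simp add: cscalar_self power2_eq_square)
    finally have "cmod (u \<bullet>c y) = l2_norm u" by simp
    with le[OF x y] show ?thesis by (simp add: u_def)
  qed
qed

lemma mat_norm_nonneg: "A \<in> carrier_mat n m \<Longrightarrow> 0 \<le> mat_norm A"
  by (rule order_trans[OF norm_ge_zero form_le_mat_norm[of A n m "0\<^sub>v m" "0\<^sub>v n"]]) auto

lemma mat_norm_le_sum: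
  assumes A: "A \<in> carrier_mat n m"
  shows "mat_norm A \<le> (\<Sum>i<n. \<Sum>k<m. cmod (A $$ (i, k)))"
proof (rule mat_norm_le[OF A])
  show "0 \<le> (\<Sum>i<n. \<Sum>k<m. cmod (A $$ (i, k)))" by (intro sum_nonneg) auto
  fix x y assume x: "x \<in> carrier_vec m" "l2_norm x \<le> 1" and y: "y \<in> carrier_vec n" "l2_norm y \<le> 1"
  have "cmod ((A *\<^sub>v x) \<bullet>c y) \<le> l2_norm (A *\<^sub>v x) * l2_norm y"
    using A x y by (intro cauchy_schwarz_cscalar[of _ n]) auto
  also have "\<dots> \<le> l2_norm (A *\<^sub>v x) * 1" using y by (intro mult_left_mono) auto
  also have "\<dots> \<le> (\<Sum>i<n. \<Sum>k<m. cmod (A $$ (i, k))) * l2_norm x"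
    using l2_norm_mult_le[OF A x(1)] by simp
  also have "\<dots> \<le> (\<Sum>i<n. \<Sum>k<m. cmod (A $$ (i, k))) * 1"
    using x by (intro mult_left_mono sum_nonneg) auto
  finally show "cmod ((A *\<^sub>v x) \<bullet>c y) \<le> (\<Sum>i<n. \<Sum>k<m. cmod (A $$ (i, k)))" by simp
qed

lemma entry_form:
  assumes A: "(A :: complex mat) \<in> carrier_mat n m" and "i < n" "k < m"
  shows "(A *\<^sub>v unit_vec m k) \<bullet>c unit_vec n i = A $$ (i, k)"
proof -
  have "(A *\<^sub>v unit_vec m k) \<bullet>c unit_vec n i = (A *\<^sub>v unit_vec m k) $ i"
    using assms by (intro cscalar_unit_vec) auto
  also have "\<dots> = A $$ (i, k)"
    using assms by (simp add: mult_mat_vec_index_sum[OF A] if_distrib cong: if_cong del: index_mult_mat_vec)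
  finally show ?thesis .
qed

lemma entry_le_mat_norm:
  assumes A: "A \<in> carrier_mat n m" and "i < n" "k < m"
  shows "cmod (A $$ (i, k)) \<le> mat_norm A"
  using form_le_mat_norm[OF A, of "unit_vec m k" "unit_vec n i"] assms by (simp add: entry_form)

lemma zero_mat_formI:
  assumes A: "(A :: complex mat) \<in> carrier_mat n m"
    and "\<And>x y. x \<in> carrier_vec m \<Longrightarrow> y \<in> carrier_vec n \<Longrightarrow> (A *\<^sub>v x) \<bullet>c y = 0"
  shows "A = 0\<^sub>m n m"
proof (rule eq_matI)
  fix i k assume "i < dim_row (0\<^sub>m n m)" "k < dim_col (0\<^sub>m n m)"
  hence "i < n" "k < m" by auto
  with assms(2)[of "unit_vec m k" "unit_vec n i"] show "A $$ (i, k) = 0\<^sub>m n m $$ (i, k)"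
    by (simp add: entry_form[OF A])
qed (use A in auto)

lemma mat_sum_carrier [simp]: "mat_sum n F S \<in> carrier_mat n n"
  by (simp add: mat_sum_def)

lemma form_entries:
  assumes A: "(A :: complex mat) \<in> carrier_mat n n" and x: "x \<in> carrier_vec n" and y: "y \<in> carrier_vec n"
  shows "(A *\<^sub>v x) \<bullet>c y = (\<Sum>i<n. \<Sum>k<n. A $$ (i, k) * x $ k * cnj (y $ i))"
  unfolding cscalar_sum_carrier[OF y]
  by (intro sum.cong refl) (simp add: mult_mat_vec_index_sum[OF A x] sum_distrib_right
      del: index_mult_mat_vec)

lemma mat_sum_form:
  assumes F: "\<And>a. a \<in> S \<Longrightarrow> F a \<in> carrier_mat n n"
    and x: "x \<in> carrier_vec n" and y: "y \<in> carrier_vec n"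
  shows "(mat_sum n F S *\<^sub>v x) \<bullet>c y = (\<Sum>a\<in>S. (F a *\<^sub>v x) \<bullet>c y)"
proof -
  have "(mat_sum n F S *\<^sub>v x) \<bullet>c y
      = (\<Sum>i<n. \<Sum>k<n. \<Sum>a\<in>S. F a $$ (i, k) * x $ k * cnj (y $ i))"
    unfolding form_entries[OF mat_sum_carrier x y]
    by (intro sum.cong refl) (simp add: mat_sum_def sum_distrib_right)
  also have "\<dots> = (\<Sum>i<n. \<Sum>a\<in>S. \<Sum>k<n. F a $$ (i, k) * x $ k * cnj (y $ i))"
    by (intro sum.cong refl sum.swap)
  also have "\<dots> = (\<Sum>a\<in>S. \<Sum>i<n. \<Sum>k<n. F a $$ (i, k) * x $ k * cnj (y $ i))"
    by (rule sum.swap)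
  also have "\<dots> = (\<Sum>a\<in>S. (F a *\<^sub>v x) \<bullet>c y)"
    by (intro sum.cong refl form_entries[OF F x y, symmetric])
  finally show ?thesis .
qed

lemma smult_form:
  assumes "(A :: complex mat) \<in> carrier_mat n n" "x \<in> carrier_vec n" "y \<in> carrier_vec n"
  shows "((c \<cdot>\<^sub>m A) *\<^sub>v x) \<bullet>c y = c * ((A *\<^sub>v x) \<bullet>c y)"
proof -
  have cA: "c \<cdot>\<^sub>m A \<in> carrier_mat n n" using assms by simp
  show ?thesis
    unfolding form_entries[OF cA assms(2,3)] form_entries[OF assms] sum_distrib_left
    using assms by (intro sum.cong refl) (auto simp: mult.assoc)
qed

section \<open>Moments of words\<close>

lemma word_eval_carrier [simp]: "X \<in> mtuples n \<Longrightarrow> word_eval n X w \<in> carrier_mat n n"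
  by (induction w) (auto simp: mtuples_def intro!: mult_carrier_mat)

text \<open>
  For fixed \<open>X\<close>, \<open>x\<close> and \<open>y\<close> this is a linear functional on polynomials, given by its values on
  the words. Functionals of this kind play the role of the unit ball of the dual space.
\<close>

definition moment :: "nat \<Rightarrow> 'd mtuple \<Rightarrow> complex vec \<Rightarrow> complex vec \<Rightarrow> 'd list \<Rightarrow> complex" where
  "moment n X x y w = (word_eval n X w *\<^sub>v x) \<bullet>c y"

lemma poly_eval_carrier [simp]: "poly_eval n S p X \<in> carrier_mat n n"
  by (simp add: poly_eval_def)

lemma poly_eval_form:
  assumes X: "X \<in> mtuples n" and x: "x \<in> carrier_vec n" and y: "y \<in> carrier_vec n"
  shows "(poly_eval n S p X *\<^sub>v x) \<bullet>c y = (\<Sum>w\<in>S. p w * moment n X x y w)"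
  unfolding poly_eval_def moment_def
  using word_eval_carrier[OF X] x y
  by (simp add: mat_sum_form[OF smult_carrier_mat[OF word_eval_carrier[OF X]] x y]
    smult_form[OF word_eval_carrier[OF X] x y])

lemma word_eval_append:
  assumes X: "X \<in> mtuples n"
  shows "word_eval n X (u @ v) = word_eval n X u * word_eval n X v"
proof (induction u)
  case Nil thus ?case using word_eval_carrier[OF X, of v] by simp
next
  case (Cons j u)
  have "X j \<in> carrier_mat n n" using X by (simp add: mtuples_def)
  from assoc_mult_mat[OF this word_eval_carrier[OF X] word_eval_carrier[OF X]]
  show ?case using Cons by simp
qed

section \<open>Matrix convex sets\<close>

lemma adjoint_mult_index:
  fixes A B :: "complex mat"
  assumes A: "A \<in> carrier_mat n k" and B: "B \<in> carrier_mat n l" and i: "i < k" and j: "j < l"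
  shows "(mat_adjoint A * B) $$ (i, j) = col B j \<bullet>c col A i"
proof -
  have "(mat_adjoint A * B) $$ (i, j) = row (mat_adjoint A) i \<bullet> col B j"
    using A B i j by simp
  also have "row (mat_adjoint A) i = conjugate (col A i)"
    using A i by (intro eq_vecI) (auto simp: mat_adjoint_index[OF A] mat_adjoint_def mat_of_rows_index)
  also have "conjugate (col A i) \<bullet> col B j = col B j \<bullet>c col A i"
    using A B i j by (intro comm_scalar_prod[of _ n]) auto
  finally show ?thesis .
qed

lemma adjoint_conj_index:
  fixes A B :: "complex mat"
  assumes A: "A \<in> carrier_mat n k" and B: "B \<in> carrier_mat n n" and i: "i < k" and j: "j < k"
  shows "(mat_adjoint A * B * A) $$ (i, j) = (B *\<^sub>v col A j) \<bullet>c col A i"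
proof -
  have "mat_adjoint A * B * A = mat_adjoint A * (B * A)"
    by (rule assoc_mult_mat[OF mat_adjoint_carrier[OF A] B A])
  also have "\<dots> $$ (i, j) = col (B * A) j \<bullet>c col A i"
    by (rule adjoint_mult_index[OF A mult_carrier_mat[OF B A] i j])
  finally show ?thesis using col_mult2[OF B A j] by simp
qed

lemma matrix_convex_mtuples:
  "matrix_convex K \<Longrightarrow> 1 \<le> n \<Longrightarrow> X \<in> K n \<Longrightarrow> X \<in> mtuples n"
  unfolding matrix_convex_def by blast

lemma matrix_convex_direct_sum:
  "matrix_convex K \<Longrightarrow> 1 \<le> n \<Longrightarrow> 1 \<le> m \<Longrightarrow> X \<in> K n \<Longrightarrow> Y \<in> K m \<Longrightarrow> direct_sum X Y \<in> K (n + m)"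
  unfolding matrix_convex_def by blast

lemma matrix_convex_compression:
  "matrix_convex K \<Longrightarrow> 1 \<le> m \<Longrightarrow> 1 \<le> n \<Longrightarrow> X \<in> K m \<Longrightarrow> \<alpha> \<in> carrier_mat m n \<Longrightarrow>
    mat_adjoint \<alpha> * \<alpha> = 1\<^sub>m n \<Longrightarrow> (\<lambda>j. mat_adjoint \<alpha> * X j * \<alpha>) \<in> K n"
  unfolding matrix_convex_def by blast

text \<open>
  The isometry \<open>\<alpha>\<close> in the definition of matrix convexity is used in the form of its columns, so
  that only inner products have to be computed.
\<close>

lemma compression_to_orthonormal_family:
  fixes c :: "nat \<Rightarrow> complex vec"
  assumes K: "matrix_convex K" and L: "1 \<le> L" and n: "1 \<le> n" and Y: "Y \<in> K L"
    and c: "\<And>i. i < n \<Longrightarrow> c i \<in> carrier_vec L"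
    and orth: "\<And>i j. i < n \<Longrightarrow> j < n \<Longrightarrow> c j \<bullet>c c i = (if i = j then 1 else 0)"
  shows "(\<lambda>p. mat n n (\<lambda>(i, j). (Y p *\<^sub>v c j) \<bullet>c c i)) \<in> K n"
proof -
  define \<alpha> where "\<alpha> = mat L n (\<lambda>(r, j). c j $ r)"
  have a: "\<alpha> \<in> carrier_mat L n" by (simp add: \<alpha>_def)
  have col: "col \<alpha> i = c i" if "i < n" for i
    using c[OF that] that by (intro eq_vecI) (auto simp: \<alpha>_def)
  have Yp: "Y p \<in> carrier_mat L L" for p
    using matrix_convex_mtuples[OF K L Y] by (simp add: mtuples_def)
  have "mat_adjoint \<alpha> * \<alpha> = 1\<^sub>m n"
  proof (rule eq_matI)
    fix i j assume "i < dim_row (1\<^sub>m n)" "j < dim_col (1\<^sub>m n)"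
    hence ij: "i < n" "j < n" by auto
    show "(mat_adjoint \<alpha> * \<alpha>) $$ (i, j) = 1\<^sub>m n $$ (i, j)"
      unfolding adjoint_mult_index[OF a a ij] using ij by (simp add: col orth)
  qed (use a in auto)
  from matrix_convex_compression[OF K L n Y a this]
  have "(\<lambda>p. mat_adjoint \<alpha> * Y p * \<alpha>) \<in> K n" .
  moreover have "mat_adjoint \<alpha> * Y p * \<alpha> = mat n n (\<lambda>(i, j). (Y p *\<^sub>v c j) \<bullet>c c i)" for p
  proof (rule eq_matI)
    fix i j assume "i < dim_row (mat n n (\<lambda>(i, j). (Y p *\<^sub>v c j) \<bullet>c c i))"
      "j < dim_col (mat n n (\<lambda>(i, j). (Y p *\<^sub>v c j) \<bullet>c c i))"
    hence ij: "i < n" "j < n" by auto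
    show "(mat_adjoint \<alpha> * Y p * \<alpha>) $$ (i, j) = mat n n (\<lambda>(i, j). (Y p *\<^sub>v c j) \<bullet>c c i) $$ (i, j)"
      unfolding adjoint_conj_index[OF a Yp ij] using ij by (simp add: col)
  qed (use a in auto)
  ultimately show ?thesis by simp
qed

lemma zero_mat_mult_vec:
  "(x :: complex vec) \<in> carrier_vec m \<Longrightarrow> 0\<^sub>m n m *\<^sub>v x = 0\<^sub>v n"
  by (intro eq_vecI) auto

lemma mult_mat_zero_vec:
  "(A :: complex mat) \<in> carrier_mat n m \<Longrightarrow> A *\<^sub>v 0\<^sub>v m = 0\<^sub>v n"
  by (intro eq_vecI) (auto simp: mult_mat_vec_index_sum[of A n m] simp del: index_mult_mat_vec)

lemma direct_sum_four_block:
  "X j \<in> carrier_mat n n \<Longrightarrow> Y j \<in> carrier_mat m m \<Longrightarrow>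
    direct_sum X Y j = four_block_mat (X j) (0\<^sub>m n m) (0\<^sub>m m n) (Y j)"
  unfolding direct_sum_def diag_block_mat.simps(2)[of "X j"] diag_block_mat_singleton Let_def
  by auto

lemma direct_sum_mtuples:
  "X \<in> mtuples n \<Longrightarrow> Y \<in> mtuples m \<Longrightarrow> direct_sum X Y \<in> mtuples (n + m)"
  by (auto simp: mtuples_def direct_sum_four_block[of X _ n Y m])

lemma direct_sum_mult_vec:
  assumes "X \<in> mtuples n" "Y \<in> mtuples m" "x \<in> carrier_vec n" "y \<in> carrier_vec m"
  shows "direct_sum X Y j *\<^sub>v (x @\<^sub>v y) = (X j *\<^sub>v x) @\<^sub>v (Y j *\<^sub>v y)"
proof -
  have X: "X j \<in> carrier_mat n n" and Y: "Y j \<in> carrier_mat m m"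
    using assms by (auto simp: mtuples_def)
  have "direct_sum X Y j *\<^sub>v (x @\<^sub>v y)
      = (X j *\<^sub>v x + 0\<^sub>m n m *\<^sub>v y) @\<^sub>v (0\<^sub>m m n *\<^sub>v x + Y j *\<^sub>v y)"
    unfolding direct_sum_four_block[of X j n Y m, OF X Y]
    by (rule four_block_mat_mult_vec[OF X _ _ Y assms(3,4)]) auto
  thus ?thesis using X Y assms(3,4) by (simp add: zero_mat_mult_vec)
qed

lemma word_eval_Cons_mult_vec:
  assumes X: "X \<in> mtuples n" and x: "x \<in> carrier_vec n"
  shows "word_eval n X (j # w) *\<^sub>v x = X j *\<^sub>v (word_eval n X w *\<^sub>v x)"
proof -
  have "X j \<in> carrier_mat n n" using X by (simp add: mtuples_def)
  from assoc_mult_mat_vec[OF this word_eval_carrier[OF X] x] show ?thesis by simp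
qed

lemma word_eval_vec_carrier:
  "X \<in> mtuples n \<Longrightarrow> x \<in> carrier_vec n \<Longrightarrow> word_eval n X w *\<^sub>v x \<in> carrier_vec n"
  by (rule mult_mat_vec_carrier[OF word_eval_carrier])

lemma word_eval_direct_sum:
  assumes X: "X \<in> mtuples n" and Y: "Y \<in> mtuples m" and x: "x \<in> carrier_vec n" and y: "y \<in> carrier_vec m"
  shows "word_eval (n + m) (direct_sum X Y) w *\<^sub>v (x @\<^sub>v y)
    = (word_eval n X w *\<^sub>v x) @\<^sub>v (word_eval m Y w *\<^sub>v y)"
proof (induction w)
  case Nil thus ?case using x y by simp
next
  case (Cons j w)
  have "x @\<^sub>v y \<in> carrier_vec (n + m)" using x y by simp
  thus ?case
    using Cons direct_sum_mult_vec[OF X Y word_eval_vec_carrier[OF X x] word_eval_vec_carrier[OF Y y]]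
    by (simp only: word_eval_Cons_mult_vec[OF direct_sum_mtuples[OF X Y]]
        word_eval_Cons_mult_vec[OF X x] word_eval_Cons_mult_vec[OF Y y])
qed

lemma cscalar_append:
  fixes x x' :: "complex vec"
  assumes "x \<in> carrier_vec n" "x' \<in> carrier_vec n" "y \<in> carrier_vec m" "y' \<in> carrier_vec m"
  shows "(x @\<^sub>v y) \<bullet>c (x' @\<^sub>v y') = x \<bullet>c x' + y \<bullet>c y'"
proof -
  have "conjugate (x' @\<^sub>v y') = conjugate x' @\<^sub>v conjugate y'"
    using assms by (intro eq_vecI) auto
  thus ?thesis using assms by (simp add: scalar_prod_append[of _ n _ m])
qed

lemma moment_direct_sum:
  assumes X: "X \<in> mtuples n" and Y: "Y \<in> mtuples m"
    and "x \<in> carrier_vec n" "y \<in> carrier_vec m" "x' \<in> carrier_vec n" "y' \<in> carrier_vec m"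
  shows "moment (n + m) (direct_sum X Y) (x @\<^sub>v y) (x' @\<^sub>v y') w = moment n X x x' w + moment m Y y y' w"
  unfolding moment_def word_eval_direct_sum[OF X Y assms(3,4)]
  by (intro cscalar_append[of _ n _ _ m] word_eval_vec_carrier assms)

lemma word_eval_zero_iff_moments:
  assumes X: "X \<in> mtuples n"
  shows "word_eval n X w = 0\<^sub>m n n \<longleftrightarrow> (\<forall>x\<in>carrier_vec n. \<forall>y\<in>carrier_vec n. moment n X x y w = 0)"
proof
  assume "\<forall>x\<in>carrier_vec n. \<forall>y\<in>carrier_vec n. moment n X x y w = 0"
  thus "word_eval n X w = 0\<^sub>m n n"
    unfolding moment_def using word_eval_carrier[OF X] by (intro zero_mat_formI) auto
qed (simp add: moment_def zero_mat_mult_vec)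

lemma nilpotent_direct_sum:
  assumes X: "X \<in> mtuples n" and Y: "Y \<in> mtuples m"
    and "nilpotent_wrt n \<Lambda> X" "nilpotent_wrt m \<Lambda> Y"
  shows "nilpotent_wrt (n + m) \<Lambda> (direct_sum X Y)"
  unfolding nilpotent_wrt_def
proof (intro allI impI)
  fix v assume "v \<notin> \<Lambda>"
  hence 0: "word_eval n X v = 0\<^sub>m n n" "word_eval m Y v = 0\<^sub>m m m"
    using assms by (auto simp: nilpotent_wrt_def)
  show "word_eval (n + m) (direct_sum X Y) v = 0\<^sub>m (n + m) (n + m)"
    unfolding word_eval_zero_iff_moments[OF direct_sum_mtuples[OF X Y]]
  proof (intro ballI)
    fix x y :: "complex vec" assume xy: "x \<in> carrier_vec (n + m)" "y \<in> carrier_vec (n + m)"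
    have "moment (n + m) (direct_sum X Y) (vec_first x n @\<^sub>v vec_last x m) (vec_first y n @\<^sub>v vec_last y m) v
      = moment n X (vec_first x n) (vec_first y n) v + moment m Y (vec_last x m) (vec_last y m) v"
      by (intro moment_direct_sum X Y) auto
    also have "\<dots> = 0" using 0 by (simp add: moment_def zero_mat_mult_vec)
    finally show "moment (n + m) (direct_sum X Y) x y v = 0" using xy by simp
  qed
qed

section \<open>Compression to the orthogonal complement of a vector\<close>

text \<open>
  Gram--Schmidt on a basis that starts with \<open>h\<close> gives an orthogonal basis of which \<open>h\<close> is the first
  member; the other members, normalised, are the columns of \<open>\<alpha>\<close>. The last conclusion says that
  \<open>\<alpha> \<alpha>\<^sup>*\<close> is the orthogonal projection that kills \<open>h\<close>; it is the expansion of \<open>u\<close> in that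
  basis without its first term.
\<close>

lemma orthogonal_complement_isometry:
  fixes h :: "complex vec"
  assumes h: "h \<in> carrier_vec (Suc m)" and h0: "h \<noteq> 0\<^sub>v (Suc m)"
  obtains \<alpha> where "\<alpha> \<in> carrier_mat (Suc m) m" "mat_adjoint \<alpha> * \<alpha> = 1\<^sub>m m"
    "\<And>u. u \<in> carrier_vec (Suc m) \<Longrightarrow>
      \<alpha> *\<^sub>v (mat_adjoint \<alpha> *\<^sub>v u) = u + (- (u \<bullet>c h / (h \<bullet>c h))) \<cdot>\<^sub>v h"
proof -
  interpret V: cof_vec_space "Suc m" "TYPE(complex)" .
  define ws where "ws = gram_schmidt (Suc m) (basis_completion h)"
  note bc = V.basis_completion[OF h h0]
  have hd: "basis_completion h = h # tl (basis_completion h)"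
    using bc(6,7) by (cases "basis_completion h") auto
  note gs = V.gram_schmidt_result[OF bc(2) bc(4) bc(5) ws_def]
  have len: "length ws = Suc m" using gs(4) bc(6) by simp
  have "hd ws = h" unfolding ws_def by (subst hd) (rule V.gram_schmidt_hd[OF h])
  hence ws0: "ws ! 0 = h" using len by (cases ws) auto
  have wc: "ws ! k \<in> carrier_vec (Suc m)" if "k < Suc m" for k
    using gs(3) len that by (metis nth_mem subsetD)
  have wn0: "ws ! k \<bullet>c ws ! k \<noteq> 0" if "k < Suc m" for k
    using corthogonalD[OF gs(2), of k k] that len by simp
  have worth: "ws ! k \<bullet>c ws ! l = 0" if "k < Suc m" "l < Suc m" "k \<noteq> l" for k l
    using corthogonalD[OF gs(2), of k l] that len by simp
  define W where "W = mat_of_rows (Suc m) (map vec_inv ws)"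
  have Wc: "W \<in> carrier_mat (Suc m) (Suc m)" and Vc: "mat_of_cols (Suc m) ws \<in> carrier_mat (Suc m) (Suc m)"
    using len mat_of_rows_carrier(1)[of "Suc m" "map vec_inv ws"] mat_of_cols_carrier(1)[of "Suc m" ws]
    by (auto simp: W_def)
  have "W * mat_of_cols (Suc m) ws = 1\<^sub>m (Suc m)"
    using corthogonal_inv[OF gs(2,3)] Wc len unfolding inverts_mat_def W_def by auto
  hence VW: "mat_of_cols (Suc m) ws * W = 1\<^sub>m (Suc m)"
    by (rule mat_mult_left_right_inverse[OF Wc Vc])
  have Wvec: "W *\<^sub>v u = vec (Suc m) (\<lambda>k. (u \<bullet>c ws ! k) / (ws ! k \<bullet>c ws ! k))"
    if u: "u \<in> carrier_vec (Suc m)" for u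
  proof (rule eq_vecI)
    fix k assume "k < dim_vec (vec (Suc m) (\<lambda>k. (u \<bullet>c ws ! k) / (ws ! k \<bullet>c ws ! k)))"
    hence k: "k < Suc m" by simp
    have "(W *\<^sub>v u) $ k = row W k \<bullet> u" using Wc k by simp
    also have "row W k = vec_inv (ws ! k)"
      unfolding W_def using k len wc[OF k] by (subst mat_of_rows_row) auto
    also have "vec_inv (ws ! k) \<bullet> u = 1 / (ws ! k \<bullet>c ws ! k) * (conjugate (ws ! k) \<bullet> u)"
      unfolding vec_inv_def using wc[OF k] u by (intro smult_scalar_prod_distrib) auto
    also have "conjugate (ws ! k) \<bullet> u = u \<bullet>c ws ! k"
      using wc[OF k] u by (intro comm_scalar_prod[of _ "Suc m"]) auto
    finally show "(W *\<^sub>v u) $ k = vec (Suc m) (\<lambda>k. (u \<bullet>c ws ! k) / (ws ! k \<bullet>c ws ! k)) $ k"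
      using k by simp
  qed (use Wc in auto)
  have expand: "u $ i = (\<Sum>k<Suc m. ws ! k $ i * ((u \<bullet>c ws ! k) / (ws ! k \<bullet>c ws ! k)))"
    if u: "u \<in> carrier_vec (Suc m)" and i: "i < Suc m" for u i
  proof -
    have "u = mat_of_cols (Suc m) ws *\<^sub>v (W *\<^sub>v u)"
      using VW assoc_mult_mat_vec[OF Vc Wc u] u by simp
    hence "u $ i = (mat_of_cols (Suc m) ws *\<^sub>v (W *\<^sub>v u)) $ i" by simp
    also have "\<dots> = (\<Sum>k<Suc m. mat_of_cols (Suc m) ws $$ (i, k) * (W *\<^sub>v u) $ k)"
      by (rule mult_mat_vec_index_sum[OF Vc _ i]) (use mult_mat_vec_carrier[OF Wc u] in simp)
    also have "\<dots> = (\<Sum>k<Suc m. ws ! k $ i * ((u \<bullet>c ws ! k) / (ws ! k \<bullet>c ws ! k)))"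
      using len i by (intro sum.cong refl) (simp add: mat_of_cols_index Wvec[OF u])
    finally show ?thesis .
  qed
  define N where "N k = complex_of_real (1 / l2_norm (ws ! k))" for k
  have NN: "N k * N k = 1 / (ws ! k \<bullet>c ws ! k)" for k
    by (simp add: N_def cscalar_self power2_eq_square)
  define \<alpha> where "\<alpha> = mat (Suc m) m (\<lambda>(i, k). N (Suc k) * ws ! Suc k $ i)"
  have ac: "\<alpha> \<in> carrier_mat (Suc m) m" by (simp add: \<alpha>_def)
  have acol: "col \<alpha> k = N (Suc k) \<cdot>\<^sub>v ws ! Suc k" if "k < m" for k
    using that wc[of "Suc k"] by (intro eq_vecI) (auto simp: \<alpha>_def)
  have sm: "(a \<cdot>\<^sub>v x) \<bullet>c (b \<cdot>\<^sub>v y) = a * cnj b * (x \<bullet>c y)"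
    if "x \<in> carrier_vec (Suc m)" "y \<in> carrier_vec (Suc m)" for a b :: complex and x y
  proof -
    have "b \<cdot>\<^sub>v y \<in> carrier_vec (Suc m)" using that by simp
    thus ?thesis using that
      by (simp add: cscalar_sum_carrier[of _ "Suc m"] sum_distrib_left mult.assoc mult.left_commute
          del: sum.lessThan_Suc)
  qed
  show ?thesis
  proof (rule that[OF ac])
    show "mat_adjoint \<alpha> * \<alpha> = 1\<^sub>m m"
    proof (rule eq_matI)
      fix i j assume "i < dim_row (1\<^sub>m m)" "j < dim_col (1\<^sub>m m)"
      hence ij: "i < m" "j < m" by auto
      have "(mat_adjoint \<alpha> * \<alpha>) $$ (i, j) = N (Suc j) * cnj (N (Suc i)) * (ws ! Suc j \<bullet>c ws ! Suc i)"
        unfolding adjoint_mult_index[OF ac ac ij] acol[OF ij(1)] acol[OF ij(2)]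
        using ij wc by (intro sm) auto
      also have "\<dots> = 1\<^sub>m m $$ (i, j)"
      proof (cases "i = j")
        case True
        have "cnj (N (Suc i)) = N (Suc i)" by (simp add: N_def)
        thus ?thesis using True ij NN[of "Suc i"] wn0[of "Suc i"] by simp
      next
        case False thus ?thesis using ij worth[of "Suc j" "Suc i"] by simp
      qed
      finally show "(mat_adjoint \<alpha> * \<alpha>) $$ (i, j) = 1\<^sub>m m $$ (i, j)" .
    qed (use ac in auto)
  next
    fix u :: "complex vec" assume u: "u \<in> carrier_vec (Suc m)"
    have au: "mat_adjoint \<alpha> *\<^sub>v u \<in> carrier_vec m"
      by (rule mult_mat_vec_carrier[OF mat_adjoint_carrier[OF ac] u])
    have adj: "(mat_adjoint \<alpha> *\<^sub>v u) $ k = N (Suc k) * (u \<bullet>c ws ! Suc k)" if k: "k < m" for k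
    proof -
      have "(mat_adjoint \<alpha> *\<^sub>v u) $ k = (\<Sum>i<Suc m. mat_adjoint \<alpha> $$ (k, i) * u $ i)"
        by (rule mult_mat_vec_index_sum[OF mat_adjoint_carrier[OF ac] u k])
      also have "\<dots> = (\<Sum>i<Suc m. N (Suc k) * (u $ i * cnj (ws ! Suc k $ i)))"
      proof (intro sum.cong refl)
        fix i assume "i \<in> {..<Suc m}"
        hence i: "i < Suc m" by simp
        have "\<alpha> $$ (i, k) = N (Suc k) * ws ! Suc k $ i" using i k by (simp add: \<alpha>_def)
        thus "mat_adjoint \<alpha> $$ (k, i) * u $ i = N (Suc k) * (u $ i * cnj (ws ! Suc k $ i))"
          unfolding mat_adjoint_index[OF ac k i] by (simp add: N_def)
      qed
      also have "\<dots> = N (Suc k) * (u \<bullet>c ws ! Suc k)"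
        using k by (simp only: cscalar_sum_carrier[OF wc] Suc_less_eq sum_distrib_left)
      finally show ?thesis .
    qed
    show "\<alpha> *\<^sub>v (mat_adjoint \<alpha> *\<^sub>v u) = u + (- (u \<bullet>c h / (h \<bullet>c h))) \<cdot>\<^sub>v h"
    proof (rule eq_vecI)
      fix i assume "i < dim_vec (u + (- (u \<bullet>c h / (h \<bullet>c h))) \<cdot>\<^sub>v h)"
      hence i: "i < Suc m" using h by simp
      have "(\<alpha> *\<^sub>v (mat_adjoint \<alpha> *\<^sub>v u)) $ i = (\<Sum>k<m. \<alpha> $$ (i, k) * (mat_adjoint \<alpha> *\<^sub>v u) $ k)"
        by (rule mult_mat_vec_index_sum[OF ac au i])
      also have "\<dots> = (\<Sum>k<m. ws ! Suc k $ i * ((u \<bullet>c ws ! Suc k) / (ws ! Suc k \<bullet>c ws ! Suc k)))"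
      proof (intro sum.cong refl)
        fix k assume "k \<in> {..<m}"
        hence k: "k < m" by simp
        have "\<alpha> $$ (i, k) * (mat_adjoint \<alpha> *\<^sub>v u) $ k
            = (N (Suc k) * N (Suc k)) * (ws ! Suc k $ i * (u \<bullet>c ws ! Suc k))"
          unfolding adj[OF k] using i k by (simp add: \<alpha>_def)
        thus "\<alpha> $$ (i, k) * (mat_adjoint \<alpha> *\<^sub>v u) $ k
            = ws ! Suc k $ i * ((u \<bullet>c ws ! Suc k) / (ws ! Suc k \<bullet>c ws ! Suc k))"
          unfolding NN by simp
      qed
      also have "\<dots> = u $ i - h $ i * ((u \<bullet>c h) / (h \<bullet>c h))"
        using expand[OF u i] unfolding sum.lessThan_Suc_shift ws0 by simp
      finally show "(\<alpha> *\<^sub>v (mat_adjoint \<alpha> *\<^sub>v u)) $ i = (u + (- (u \<bullet>c h / (h \<bullet>c h))) \<cdot>\<^sub>v h) $ i"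
        using h u i by simp
    qed (use ac h in auto)
  qed
qed

text \<open>
  Compression to the complement of \<open>h\<close> is multiplicative when the complement is invariant under \<open>X\<close>
  (and contains \<open>x\<close>), and also when the line through \<open>h\<close> is annihilated by \<open>X\<close>: in both cases the
  projection \<open>\<alpha> \<alpha>\<^sup>*\<close> that appears between two letters can be dropped.
\<close>

lemma word_eval_compression:
  fixes h :: "complex vec" and \<alpha> :: "complex mat"
  assumes X: "X \<in> mtuples (Suc m)" and h: "h \<in> carrier_vec (Suc m)"
    and \<alpha>: "\<alpha> \<in> carrier_mat (Suc m) m"
    and proj: "\<And>u. u \<in> carrier_vec (Suc m) \<Longrightarrow>
      \<alpha> *\<^sub>v (mat_adjoint \<alpha> *\<^sub>v u) = u + (- (u \<bullet>c h / (h \<bullet>c h))) \<cdot>\<^sub>v h"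
    and x: "x \<in> carrier_vec (Suc m)"
    and inv: "(x \<bullet>c h = 0 \<and> (\<forall>j. \<forall>v\<in>carrier_vec (Suc m). (X j *\<^sub>v v) \<bullet>c h = 0)) \<or>
      (\<forall>j. X j *\<^sub>v h = 0\<^sub>v (Suc m))"
  shows "word_eval m (\<lambda>j. mat_adjoint \<alpha> * X j * \<alpha>) w *\<^sub>v (mat_adjoint \<alpha> *\<^sub>v x)
    = mat_adjoint \<alpha> *\<^sub>v (word_eval (Suc m) X w *\<^sub>v x)"
proof (induction w)
  case Nil
  have "mat_adjoint \<alpha> *\<^sub>v x \<in> carrier_vec m"
    by (rule mult_mat_vec_carrier[OF mat_adjoint_carrier[OF \<alpha>] x])
  thus ?case using x by simp
next
  case (Cons j w)
  have Xj: "X i \<in> carrier_mat (Suc m) (Suc m)" for i using X by (simp add: mtuples_def)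
  let ?T = "\<lambda>j. mat_adjoint \<alpha> * X j * \<alpha>"
  have T: "?T \<in> mtuples m"
    unfolding mtuples_def using \<alpha> by auto
  have a': "mat_adjoint \<alpha> \<in> carrier_mat m (Suc m)" using \<alpha> by simp
  have ax: "mat_adjoint \<alpha> *\<^sub>v x \<in> carrier_vec m" by (rule mult_mat_vec_carrier[OF a' x])
  define u where "u = word_eval (Suc m) X w *\<^sub>v x"
  have u: "u \<in> carrier_vec (Suc m)" unfolding u_def by (rule word_eval_vec_carrier[OF X x])
  have au: "mat_adjoint \<alpha> *\<^sub>v u \<in> carrier_vec m" by (rule mult_mat_vec_carrier[OF a' u])
  have key: "X j *\<^sub>v (\<alpha> *\<^sub>v (mat_adjoint \<alpha> *\<^sub>v u)) = X j *\<^sub>v u"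
    using inv
  proof
    assume *: "x \<bullet>c h = 0 \<and> (\<forall>j. \<forall>v\<in>carrier_vec (Suc m). (X j *\<^sub>v v) \<bullet>c h = 0)"
    have "u \<bullet>c h = 0"
    proof (cases w)
      case Nil thus ?thesis using * x by (simp add: u_def)
    next
      case (Cons i w')
      thus ?thesis
        using * word_eval_vec_carrier[OF X x, of w'] by (simp add: u_def word_eval_Cons_mult_vec[OF X x] del: word_eval.simps)
    qed
    moreover have "u + 0 \<cdot>\<^sub>v h = u" using u h by auto
    ultimately show ?thesis using proj[OF u] by simp
  next
    assume *: "\<forall>j. X j *\<^sub>v h = 0\<^sub>v (Suc m)"
    have "X j *\<^sub>v (\<alpha> *\<^sub>v (mat_adjoint \<alpha> *\<^sub>v u)) = X j *\<^sub>v u + X j *\<^sub>v ((- (u \<bullet>c h / (h \<bullet>c h))) \<cdot>\<^sub>v h)"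
      unfolding proj[OF u] using h by (intro mult_add_distrib_mat_vec[OF Xj u]) auto
    also have "X j *\<^sub>v ((- (u \<bullet>c h / (h \<bullet>c h))) \<cdot>\<^sub>v h) = 0\<^sub>v (Suc m)"
      unfolding mult_mat_vec[OF Xj h] using * by (intro eq_vecI) auto
    also have "X j *\<^sub>v u + 0\<^sub>v (Suc m) = X j *\<^sub>v u"
      by (rule right_zero_vec[OF mult_mat_vec_carrier[OF Xj u]])
    finally show ?thesis .
  qed
  have "word_eval m ?T (j # w) *\<^sub>v (mat_adjoint \<alpha> *\<^sub>v x) = ?T j *\<^sub>v (mat_adjoint \<alpha> *\<^sub>v u)"
    unfolding word_eval_Cons_mult_vec[OF T ax] Cons.IH u_def ..
  also have "\<dots> = mat_adjoint \<alpha> *\<^sub>v (X j *\<^sub>v (\<alpha> *\<^sub>v (mat_adjoint \<alpha> *\<^sub>v u)))"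
    using assoc_mult_mat_vec[OF mult_carrier_mat[OF a' Xj] \<alpha> au]
      assoc_mult_mat_vec[OF a' Xj mult_mat_vec_carrier[OF \<alpha> au]] by simp
  also have "\<dots> = mat_adjoint \<alpha> *\<^sub>v (word_eval (Suc m) X (j # w) *\<^sub>v x)"
    by (simp only: key word_eval_Cons_mult_vec[OF X x] u_def[symmetric])
  finally show ?case .
qed

text \<open>
  The two alternatives for \<open>h\<close> remove a direction that the functional \<open>moment n X x y\<close> does not see:
  one outside an invariant subspace that contains \<open>x\<close>, or one inside the common kernel of the \<open>X j\<close>
  that is orthogonal to \<open>y\<close>. The functional is therefore realised in one dimension less, by a
  compression of \<open>X\<close>.
\<close>

lemma compression_preserves_moments:
  fixes h x y :: "complex vec"
  assumes X: "X \<in> mtuples (Suc m)" and h: "h \<in> carrier_vec (Suc m)" and h0: "h \<noteq> 0\<^sub>v (Suc m)"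
    and x: "x \<in> carrier_vec (Suc m)" and y: "y \<in> carrier_vec (Suc m)"
    and inv: "(x \<bullet>c h = 0 \<and> (\<forall>j. \<forall>v\<in>carrier_vec (Suc m). (X j *\<^sub>v v) \<bullet>c h = 0)) \<or>
      (y \<bullet>c h = 0 \<and> (\<forall>j. X j *\<^sub>v h = 0\<^sub>v (Suc m)))"
    and nil: "nilpotent_wrt (Suc m) \<Lambda> X"
  obtains \<alpha> x' y' where "\<alpha> \<in> carrier_mat (Suc m) m" "mat_adjoint \<alpha> * \<alpha> = 1\<^sub>m m"
    "nilpotent_wrt m \<Lambda> (\<lambda>j. mat_adjoint \<alpha> * X j * \<alpha>)"
    "x' \<in> carrier_vec m" "y' \<in> carrier_vec m" "l2_norm x' \<le> l2_norm x" "l2_norm y' \<le> l2_norm y"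
    "\<And>w. moment m (\<lambda>j. mat_adjoint \<alpha> * X j * \<alpha>) x' y' w = moment (Suc m) X x y w"
proof -
  obtain \<alpha> where \<alpha>: "\<alpha> \<in> carrier_mat (Suc m) m" and iso: "mat_adjoint \<alpha> * \<alpha> = 1\<^sub>m m"
    and proj: "\<And>u. u \<in> carrier_vec (Suc m) \<Longrightarrow>
      \<alpha> *\<^sub>v (mat_adjoint \<alpha> *\<^sub>v u) = u + (- (u \<bullet>c h / (h \<bullet>c h))) \<cdot>\<^sub>v h"
    using orthogonal_complement_isometry[OF h h0] by blast
  let ?T = "\<lambda>j. mat_adjoint \<alpha> * X j * \<alpha>"
  have a': "mat_adjoint \<alpha> \<in> carrier_mat m (Suc m)" using \<alpha> by simp
  have ac: "mat_adjoint \<alpha> *\<^sub>v u \<in> carrier_vec m" if "u \<in> carrier_vec (Suc m)" for u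
    by (rule mult_mat_vec_carrier[OF a' that])
  have T: "?T \<in> mtuples m" unfolding mtuples_def using \<alpha> by auto
  have form: "(mat_adjoint \<alpha> *\<^sub>v u) \<bullet>c (mat_adjoint \<alpha> *\<^sub>v v)
      = u \<bullet>c v - (u \<bullet>c h) * (h \<bullet>c v) / (h \<bullet>c h)"
    if u: "u \<in> carrier_vec (Suc m)" and v: "v \<in> carrier_vec (Suc m)" for u v
  proof -
    have "(mat_adjoint \<alpha> *\<^sub>v u) \<bullet>c (mat_adjoint \<alpha> *\<^sub>v v) = (\<alpha> *\<^sub>v (mat_adjoint \<alpha> *\<^sub>v u)) \<bullet>c v"
      by (rule cscalar_mult_mat_vec[OF \<alpha> ac[OF u] v, symmetric])
    also have "\<dots> = u \<bullet>c v + ((- (u \<bullet>c h / (h \<bullet>c h))) \<cdot>\<^sub>v h) \<bullet>c v"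
      unfolding proj[OF u] using u v h by (intro add_scalar_prod_distrib[of _ "Suc m"]) auto
    also have "((- (u \<bullet>c h / (h \<bullet>c h))) \<cdot>\<^sub>v h) \<bullet>c v = (- (u \<bullet>c h / (h \<bullet>c h))) * (h \<bullet>c v)"
      using v h by (intro smult_scalar_prod_distrib[of _ "Suc m"]) auto
    finally show ?thesis by simp
  qed
  have cs: "h \<bullet>c v = cnj (v \<bullet>c h)" if "v \<in> carrier_vec (Suc m)" for v :: "complex vec"
    unfolding cscalar_sum_carrier[OF h] cscalar_sum_carrier[OF that] by (simp add: mult.commute del: sum.lessThan_Suc)
  have norm_le: "l2_norm (mat_adjoint \<alpha> *\<^sub>v u) \<le> l2_norm u" if u: "u \<in> carrier_vec (Suc m)" for u
  proof -
    have "complex_of_real ((l2_norm (mat_adjoint \<alpha> *\<^sub>v u))\<^sup>2)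
        = complex_of_real ((l2_norm u)\<^sup>2) - (u \<bullet>c h) * cnj (u \<bullet>c h) / complex_of_real ((l2_norm h)\<^sup>2)"
      using form[OF u u] unfolding cscalar_self cs[OF u] .
    also have "(u \<bullet>c h) * cnj (u \<bullet>c h) = complex_of_real ((cmod (u \<bullet>c h))\<^sup>2)"
      by (simp add: complex_norm_square del: of_real_power)
    also have "complex_of_real ((l2_norm u)\<^sup>2) - complex_of_real ((cmod (u \<bullet>c h))\<^sup>2) / complex_of_real ((l2_norm h)\<^sup>2)
       = complex_of_real ((l2_norm u)\<^sup>2 - (cmod (u \<bullet>c h))\<^sup>2 / (l2_norm h)\<^sup>2)" by simp
    finally have "(l2_norm (mat_adjoint \<alpha> *\<^sub>v u))\<^sup>2 = (l2_norm u)\<^sup>2 - (cmod (u \<bullet>c h))\<^sup>2 / (l2_norm h)\<^sup>2"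
      unfolding of_real_eq_iff .
    hence "(l2_norm (mat_adjoint \<alpha> *\<^sub>v u))\<^sup>2 \<le> (l2_norm u)\<^sup>2" by simp
    thus ?thesis by (rule power2_le_imp_le) simp
  qed
  have we: "word_eval m ?T w *\<^sub>v (mat_adjoint \<alpha> *\<^sub>v u) = mat_adjoint \<alpha> *\<^sub>v (word_eval (Suc m) X w *\<^sub>v u)"
    if "u \<in> carrier_vec (Suc m)" "u \<bullet>c h = 0 \<or> u = x" for u w
    using inv that by (intro word_eval_compression[OF X h \<alpha> proj]) auto
  show ?thesis
  proof (rule that[OF \<alpha> iso])
    show "nilpotent_wrt m \<Lambda> ?T"
      unfolding nilpotent_wrt_def word_eval_zero_iff_moments[OF T]
    proof (intro allI impI ballI)
      fix v and z z' :: "complex vec" assume v: "v \<notin> \<Lambda>" and z: "z \<in> carrier_vec m" "z' \<in> carrier_vec m"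
      have az: "\<alpha> *\<^sub>v z \<in> carrier_vec (Suc m)" by (rule mult_mat_vec_carrier[OF \<alpha> z(1)])
      have zz: "mat_adjoint \<alpha> *\<^sub>v (\<alpha> *\<^sub>v z) = z"
        using assoc_mult_mat_vec[OF a' \<alpha> z(1)] iso z by simp
      have "h \<bullet>c h \<noteq> 0" using h h0 by (simp add: conjugate_square_eq_0_vec[OF h])
      hence "(mat_adjoint \<alpha> *\<^sub>v h) \<bullet>c (mat_adjoint \<alpha> *\<^sub>v h) = 0" using form[OF h h] by simp
      hence "mat_adjoint \<alpha> *\<^sub>v h = 0\<^sub>v m" using conjugate_square_eq_0_vec[OF ac[OF h]] by simp
      hence "(\<alpha> *\<^sub>v z) \<bullet>c h = 0" using cscalar_mult_mat_vec[OF \<alpha> z(1) h] z by simp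
      from we[OF az disjI1[OF this], of v] have "word_eval m ?T v *\<^sub>v z = mat_adjoint \<alpha> *\<^sub>v (word_eval (Suc m) X v *\<^sub>v (\<alpha> *\<^sub>v z))"
        unfolding zz .
      also have "word_eval (Suc m) X v *\<^sub>v (\<alpha> *\<^sub>v z) = 0\<^sub>v (Suc m)"
        using nil v zero_mat_mult_vec[OF az] by (simp add: nilpotent_wrt_def)
      also have "mat_adjoint \<alpha> *\<^sub>v 0\<^sub>v (Suc m) = 0\<^sub>v m" by (rule mult_mat_zero_vec[OF a'])
      finally show "moment m ?T z z' v = 0" using z by (simp add: moment_def)
    qed
  next
    fix w
    define u where "u = word_eval (Suc m) X w *\<^sub>v x"
    have u: "u \<in> carrier_vec (Suc m)" unfolding u_def by (rule word_eval_vec_carrier[OF X x])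
    have "(u \<bullet>c h) * (h \<bullet>c y) = 0"
      using inv
    proof
      assume *: "x \<bullet>c h = 0 \<and> (\<forall>j. \<forall>v\<in>carrier_vec (Suc m). (X j *\<^sub>v v) \<bullet>c h = 0)"
      have "u \<bullet>c h = 0"
      proof (cases w)
        case Nil thus ?thesis using * x by (simp add: u_def)
      next
        case (Cons i w')
        thus ?thesis
          using * word_eval_vec_carrier[OF X x, of w'] by (simp add: u_def word_eval_Cons_mult_vec[OF X x] del: word_eval.simps)
      qed
      thus ?thesis by simp
    next
      assume "y \<bullet>c h = 0 \<and> (\<forall>j. X j *\<^sub>v h = 0\<^sub>v (Suc m))"
      thus ?thesis using cs[OF y] by simp
    qed
    thus "moment m ?T (mat_adjoint \<alpha> *\<^sub>v x) (mat_adjoint \<alpha> *\<^sub>v y) w = moment (Suc m) X x y w"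
      using form[OF u y] we[OF x, of w] by (simp add: moment_def u_def)
  qed (use ac x y norm_le in auto)
qed

section \<open>The quotient by one word\<close>

text \<open>
  The hypothesis on \<open>p\<close> in terms of moments. Read as a statement about functionals, it bounds
  \<open>p\<close> against all those that come from \<open>\<Lambda>\<close>-nilpotent points.
\<close>

definition contractive_on :: "(nat \<Rightarrow> 'd mtuple set) \<Rightarrow> 'd list set \<Rightarrow> 'd nc_series \<Rightarrow> bool" where
  "contractive_on K \<Lambda> p \<longleftrightarrow> (\<forall>n\<ge>1. \<forall>X\<in>K n. nilpotent_wrt n \<Lambda> X \<longrightarrow>
     (\<forall>x\<in>carrier_vec n. \<forall>y\<in>carrier_vec n. l2_norm x \<le> 1 \<longrightarrow> l2_norm y \<le> 1 \<longrightarrow>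
       cmod (\<Sum>w\<in>\<Lambda>. p w * moment n X x y w) \<le> 1))"

lemma contractive_onD:
  assumes "contractive_on K \<Lambda> p" "1 \<le> n" "X \<in> K n" "nilpotent_wrt n \<Lambda> X"
    "x \<in> carrier_vec n" "y \<in> carrier_vec n" "l2_norm x \<le> 1" "l2_norm y \<le> 1"
  shows "cmod (\<Sum>w\<in>\<Lambda>. p w * moment n X x y w) \<le> 1"
  using assms unfolding contractive_on_def by blast

text \<open>
  A functional that comes from a point which is nilpotent with respect to \<open>insert w \<Lambda>\<close> and that
  vanishes on \<open>w\<close> is zero or comes from a \<open>\<Lambda>\<close>-nilpotent point. This is the concrete form of the fact
  that a quotient of an operator algebra by an ideal is represented on semi-invariant subspaces.
  Let \<open>W\<close> be the value of \<open>w\<close> at \<open>X\<close>; since no longer word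
  that begins or ends with \<open>w\<close> lies in \<open>insert w \<Lambda>\<close>, \<open>W X\<^sub>j = X\<^sub>j W = 0\<close>. As
  long as \<open>W \<noteq> 0\<close>, a direction can be split off: \<open>h = W\<^sup>* y\<close> if this is nonzero (its complement is
  invariant and contains \<open>x\<close> because the moment of \<open>w\<close> vanishes), and otherwise any nonzero vector
  \<open>h\<close> in the range of \<open>W\<close> (it is annihilated by \<open>X\<close> and orthogonal to \<open>y\<close>). Induction on the
  dimension ends with \<open>W = 0\<close>, that is, with a \<open>\<Lambda>\<close>-nilpotent point, or with the zero space.
\<close>

lemma contractive_at_vanishing_moment:
  assumes K: "matrix_convex K" and p: "contractive_on K \<Lambda> p"
    and \<Lambda>: "initial_segment \<Lambda>" and w: "w \<notin> \<Lambda>"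
    and "1 \<le> n" "X \<in> K n" "nilpotent_wrt n (insert w \<Lambda>) X"
    and "x \<in> carrier_vec n" "y \<in> carrier_vec n" "l2_norm x \<le> 1" "l2_norm y \<le> 1"
    and "moment n X x y w = 0"
  shows "cmod (\<Sum>v\<in>\<Lambda>. p v * moment n X x y v) \<le> 1"
  using assms(5-)
proof (induction n arbitrary: X x y)
  case 0 thus ?case by simp
next
  case (Suc m)
  note X = matrix_convex_mtuples[OF K Suc.prems(1,2)]
  note nil = Suc.prems(3) and x = Suc.prems(4) and y = Suc.prems(5) and mom = Suc.prems(8)
  have Xj: "X i \<in> carrier_mat (Suc m) (Suc m)" for i using X by (simp add: mtuples_def)
  define W where "W = word_eval (Suc m) X w"
  have W: "W \<in> carrier_mat (Suc m) (Suc m)" unfolding W_def by (rule word_eval_carrier[OF X])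
  have nil0: "word_eval (Suc m) X v = 0\<^sub>m (Suc m) (Suc m)" if "v \<notin> \<Lambda>" "length v \<noteq> length w" for v
    using nil that unfolding nilpotent_wrt_def by auto
  have ext: "j # w \<notin> \<Lambda>" "w @ [j] \<notin> \<Lambda>" for j
    using \<Lambda> w unfolding initial_segment_def by auto
  show ?case
  proof (cases "W = 0\<^sub>m (Suc m) (Suc m)")
    case True
    hence "nilpotent_wrt (Suc m) \<Lambda> X" using nil unfolding nilpotent_wrt_def W_def by auto
    from contractive_onD[OF p Suc.prems(1,2) this x y Suc.prems(6,7)] show ?thesis .
  next
    case False
    have "\<exists>h. h \<in> carrier_vec (Suc m) \<and> h \<noteq> 0\<^sub>v (Suc m) \<and>
      ((x \<bullet>c h = 0 \<and> (\<forall>j. \<forall>v\<in>carrier_vec (Suc m). (X j *\<^sub>v v) \<bullet>c h = 0)) \<or>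
      (y \<bullet>c h = 0 \<and> (\<forall>j. X j *\<^sub>v h = 0\<^sub>v (Suc m))))"
    proof (cases "mat_adjoint W *\<^sub>v y = 0\<^sub>v (Suc m)")
      case False
      let ?h = "mat_adjoint W *\<^sub>v y"
      have h: "?h \<in> carrier_vec (Suc m)"
        by (rule mult_mat_vec_carrier[OF mat_adjoint_carrier[OF W] y])
      have "x \<bullet>c ?h = 0" using cscalar_mult_mat_vec[OF W x y] mom by (simp add: moment_def W_def)
      moreover have "(X j *\<^sub>v v) \<bullet>c ?h = 0" if v: "v \<in> carrier_vec (Suc m)" for j v
      proof -
        have Xv: "X j *\<^sub>v v \<in> carrier_vec (Suc m)" by (rule mult_mat_vec_carrier[OF Xj v])
        have "(X j *\<^sub>v v) \<bullet>c ?h = (W *\<^sub>v (X j *\<^sub>v v)) \<bullet>c y"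
          by (rule cscalar_mult_mat_vec[OF W Xv y, symmetric])
        also have "W *\<^sub>v (X j *\<^sub>v v) = (W * X j) *\<^sub>v v"
          by (rule assoc_mult_mat_vec[OF W Xj v, symmetric])
        also have "W * X j = word_eval (Suc m) X (w @ [j])"
          using Xj[of j] by (simp add: word_eval_append[OF X] W_def)
        also have "\<dots> = 0\<^sub>m (Suc m) (Suc m)" by (rule nil0) (use ext in auto)
        finally show ?thesis using v y by (simp add: zero_mat_mult_vec)
      qed
      ultimately show ?thesis using h False by blast
    next
      case True
      have "\<exists>z\<in>carrier_vec (Suc m). W *\<^sub>v z \<noteq> 0\<^sub>v (Suc m)"
      proof (rule ccontr)
        assume "\<not> ?thesis"
        hence "W = 0\<^sub>m (Suc m) (Suc m)" using W by (intro zero_mat_formI) auto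
        thus False using False by simp
      qed
      then obtain z where z: "z \<in> carrier_vec (Suc m)" and h0: "W *\<^sub>v z \<noteq> 0\<^sub>v (Suc m)" by blast
      let ?h = "W *\<^sub>v z"
      have h: "?h \<in> carrier_vec (Suc m)" by (rule mult_mat_vec_carrier[OF W z])
      have "?h \<bullet>c y = 0" using cscalar_mult_mat_vec[OF W z y] True z by simp
      hence "cnj (y \<bullet>c ?h) = 0"
        unfolding cscalar_sum_carrier[OF h] cscalar_sum_carrier[OF y] by (simp add: mult.commute del: sum.lessThan_Suc)
      moreover have "X j *\<^sub>v ?h = 0\<^sub>v (Suc m)" for j
      proof -
        have "X j *\<^sub>v ?h = word_eval (Suc m) X (j # w) *\<^sub>v z"
          unfolding word_eval_Cons_mult_vec[OF X z] W_def ..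
        also have "word_eval (Suc m) X (j # w) = 0\<^sub>m (Suc m) (Suc m)"
          by (rule nil0) (use ext in auto)
        finally show ?thesis using z by (simp add: zero_mat_mult_vec)
      qed
      ultimately show ?thesis using h h0 by auto
    qed
    then obtain h where h: "h \<in> carrier_vec (Suc m)" "h \<noteq> 0\<^sub>v (Suc m)"
      and inv: "(x \<bullet>c h = 0 \<and> (\<forall>j. \<forall>v\<in>carrier_vec (Suc m). (X j *\<^sub>v v) \<bullet>c h = 0)) \<or>
        (y \<bullet>c h = 0 \<and> (\<forall>j. X j *\<^sub>v h = 0\<^sub>v (Suc m)))" by blast
    obtain \<alpha> x' y' where \<alpha>: "\<alpha> \<in> carrier_mat (Suc m) m" "mat_adjoint \<alpha> * \<alpha> = 1\<^sub>m m"
      and nil': "nilpotent_wrt m (insert w \<Lambda>) (\<lambda>j. mat_adjoint \<alpha> * X j * \<alpha>)"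
      and x': "x' \<in> carrier_vec m" "l2_norm x' \<le> l2_norm x"
      and y': "y' \<in> carrier_vec m" "l2_norm y' \<le> l2_norm y"
      and mom': "\<And>w. moment m (\<lambda>j. mat_adjoint \<alpha> * X j * \<alpha>) x' y' w = moment (Suc m) X x y w"
      using compression_preserves_moments[OF X h x y inv nil] by metis
    \<comment> \<open>Points have positive size; if the complement of \<open>h\<close> is trivial, all moments vanish.\<close>
    show ?thesis
    proof (cases "m = 0")
      case True
      have "moment (Suc m) X x y v = 0" for v
        using mom'[of v, symmetric] y'(1) True by (simp add: moment_def cscalar_sum)
      thus ?thesis by simp
    next
      case False
      hence m: "1 \<le> m" by simp
      note TK = matrix_convex_compression[OF K Suc.prems(1) m Suc.prems(2) \<alpha>]
      have "l2_norm x' \<le> 1" "l2_norm y' \<le> 1" using x'(2) y'(2) Suc.prems(6,7) by auto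
      from Suc.IH[OF m TK nil' x'(1) y'(1) this] show ?thesis using mom by (simp add: mom')
    qed
  qed
qed

section \<open>Choosing one more coefficient\<close>

text \<open>
  The Hahn--Banach theorem in the plane \<open>\<complex>\<^sup>2\<close>: a functional bounded on the slice \<open>b = 0\<close> extends
  with the same bound. The ray \<open>{(s, 0). s > 1}\<close> is disjoint from \<open>C\<close>, and a functional that
  separates \<open>C\<close> from the whole ray yields the constant \<open>1\<close> at once.
\<close>

lemma circled_convex_separation:
  fixes C :: "(complex \<times> complex) set"
  assumes convex: "convex C"
    and circled: "\<And>a b u. (a, b) \<in> C \<Longrightarrow> cmod u \<le> 1 \<Longrightarrow> (u * a, u * b) \<in> C"
    and slice: "\<And>a. (a, 0) \<in> C \<Longrightarrow> cmod a \<le> 1"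
  obtains c where "\<And>a b. (a, b) \<in> C \<Longrightarrow> cmod (a + c * b) \<le> 1"
proof (cases "C = {}")
  case True thus ?thesis using that by blast
next
  case False
  \<comment> \<open>If \<open>R\<close> and \<open>C\<close> are separated by \<open>(\<alpha>, \<beta>)\<close>, then \<open>Re (\<alpha> a + \<beta> b) \<le> Re \<alpha>\<close> on \<open>C\<close>, and
    \<open>c = \<beta> / \<alpha>\<close> is the required constant.\<close>
  define R where "R = (\<lambda>s. (complex_of_real s, 0 :: complex)) ` {1<..}"
  have "convex R"
    unfolding R_def by (intro convex_linear_image linearI) (auto simp: scaleR_conv_of_real)
  moreover have "R \<noteq> {}" by (auto simp: R_def intro!: exI[of _ 2])
  moreover have "C \<inter> R = {}" using slice by (force simp: R_def)
  ultimately obtain a0 :: "complex \<times> complex" and B where ab: "a0 \<noteq> 0"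
    and sepC: "\<And>z. z \<in> C \<Longrightarrow> inner a0 z \<le> B" and sepR: "\<And>z. z \<in> R \<Longrightarrow> B \<le> inner a0 z"
    using separating_hyperplane_sets[OF convex _ False] by metis
  define \<alpha> \<beta> where "\<alpha> = cnj (fst a0)" and "\<beta> = cnj (snd a0)"
  have in_eq: "inner a0 (a, b) = Re (\<alpha> * a + \<beta> * b)" for a b
    by (cases a0) (simp add: \<alpha>_def \<beta>_def inner_complex_def)
  have "B \<le> Re \<alpha>"
  proof (rule field_le_epsilon)
    fix e :: real assume e: "0 < e"
    define s where "s = 1 + e / (\<bar>Re \<alpha>\<bar> + 1)"
    have "1 < s" using e by (simp add: s_def add_nonneg_pos)
    hence "(complex_of_real s, 0) \<in> R" by (auto simp: R_def)
    from sepR[OF this] have "B \<le> Re \<alpha> * s" by (simp add: in_eq)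
    also have "\<dots> = Re \<alpha> + Re \<alpha> * (e / (\<bar>Re \<alpha>\<bar> + 1))" by (simp add: s_def algebra_simps)
    also have "Re \<alpha> * (e / (\<bar>Re \<alpha>\<bar> + 1)) \<le> (\<bar>Re \<alpha>\<bar> + 1) * (e / (\<bar>Re \<alpha>\<bar> + 1))"
      using e by (intro mult_right_mono) auto
    also have "\<dots> = e" by simp
    finally show "B \<le> Re \<alpha> + e" by simp
  qed
  also have "Re \<alpha> \<le> cmod \<alpha>" by (rule complex_Re_le_cmod)
  finally have B: "B \<le> cmod \<alpha>" .
  have bound: "cmod (\<alpha> * a + \<beta> * b) \<le> cmod \<alpha>" if "(a, b) \<in> C" for a b
  proof -
    define z where "z = \<alpha> * a + \<beta> * b"
    define u where "u = cnj (sgn z)"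
    have "cmod u \<le> 1" by (simp add: u_def norm_sgn)
    from sepC[OF circled[OF that this]] have "Re (u * z) \<le> B"
      by (simp add: in_eq z_def algebra_simps)
    moreover have "u * z = complex_of_real (cmod z)"
      unfolding u_def by (cases "z = 0")
        (auto simp: sgn_eq complex_norm_square[symmetric] power2_eq_square mult.commute[of "cnj z"] field_simps)
    ultimately have "cmod z \<le> B" by simp
    thus ?thesis using B by (simp add: z_def)
  qed
  show ?thesis
  proof (cases "\<alpha> = 0")
    case True
    \<comment> \<open>The separating hyperplane contains the ray; then \<open>C\<close> lies in the slice.\<close>
    hence "\<beta> \<noteq> 0" using ab by (auto simp: \<alpha>_def \<beta>_def prod_eq_iff)
    hence "b = 0" if "(a, b) \<in> C" for a b using bound[OF that] True by simp
    thus ?thesis using slice by (intro that[of 0]) auto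
  next
    case False
    show ?thesis
    proof (rule that[of "\<beta> / \<alpha>"])
      fix a b assume "(a, b) \<in> C"
      have "a + \<beta> / \<alpha> * b = (\<alpha> * a + \<beta> * b) / \<alpha>" using False by (simp add: field_simps)
      thus "cmod (a + \<beta> / \<alpha> * b) \<le> 1"
        using bound[OF \<open>(a, b) \<in> C\<close>] False by (simp add: norm_divide)
    qed
  qed
qed

lemma moment_smult:
  assumes X: "X \<in> mtuples n" and x: "x \<in> carrier_vec n" and y: "y \<in> carrier_vec n"
  shows "moment n X (a \<cdot>\<^sub>v x) (b \<cdot>\<^sub>v y) w = a * cnj b * moment n X x y w"
proof -
  have ax: "a \<cdot>\<^sub>v x \<in> carrier_vec n" and "b \<cdot>\<^sub>v y \<in> carrier_vec n" using x y by auto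
  thus ?thesis
    unfolding moment_def form_entries[OF word_eval_carrier[OF X] x y]
      form_entries[OF word_eval_carrier[OF X] ax \<open>b \<cdot>\<^sub>v y \<in> carrier_vec n\<close>] sum_distrib_left
    using x y by (intro sum.cong refl) simp
qed

lemma l2_norm_append: "(l2_norm (x @\<^sub>v y))\<^sup>2 = (l2_norm x)\<^sup>2 + (l2_norm y)\<^sup>2"
proof -
  have "(x @\<^sub>v y) \<bullet>c (x @\<^sub>v y) = x \<bullet>c x + y \<bullet>c y"
    by (rule cscalar_append[OF carrier_vec_dim_vec carrier_vec_dim_vec carrier_vec_dim_vec carrier_vec_dim_vec])
  thus ?thesis unfolding cscalar_self of_real_add[symmetric] of_real_eq_iff .
qed

text \<open>
  The image, under evaluation at \<open>p\<close> and at \<open>w\<close>, of the functionals that come from points which are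
  nilpotent with respect to \<open>insert w \<Lambda>\<close>. A value \<open>c\<close> for the coefficient of \<open>w\<close> is admissible
  when \<open>cmod (a + c * b) \<le> 1\<close> for all \<open>(a, b)\<close> in this set.
\<close>

definition moment_range :: "(nat \<Rightarrow> 'd mtuple set) \<Rightarrow> 'd list set \<Rightarrow> 'd nc_series \<Rightarrow> 'd list \<Rightarrow> (complex \<times> complex) set" where
  "moment_range K \<Lambda> p w = {(\<Sum>v\<in>\<Lambda>. p v * moment n X x y v, moment n X x y w) | n X x y.
     1 \<le> n \<and> X \<in> K n \<and> nilpotent_wrt n (insert w \<Lambda>) X \<and> x \<in> carrier_vec n \<and> y \<in> carrier_vec n \<and>
     l2_norm x \<le> 1 \<and> l2_norm y \<le> 1}"

lemma moment_rangeI: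
  assumes "1 \<le> n" "X \<in> K n" "nilpotent_wrt n (insert w \<Lambda>) X" "x \<in> carrier_vec n" "y \<in> carrier_vec n"
    "l2_norm x \<le> 1" "l2_norm y \<le> 1"
  shows "(\<Sum>v\<in>\<Lambda>. p v * moment n X x y v, moment n X x y w) \<in> moment_range K \<Lambda> p w"
  using assms unfolding moment_range_def by blast

lemma l2_norm_convex_append:
  assumes "0 \<le> s" "0 \<le> t" "s + t = 1" "l2_norm x \<le> 1" "l2_norm y \<le> 1"
  shows "l2_norm (complex_of_real (sqrt s) \<cdot>\<^sub>v x @\<^sub>v complex_of_real (sqrt t) \<cdot>\<^sub>v y) \<le> 1"
proof (rule power2_le_imp_le)
  have "(l2_norm (complex_of_real (sqrt s) \<cdot>\<^sub>v x @\<^sub>v complex_of_real (sqrt t) \<cdot>\<^sub>v y))\<^sup>2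
      = s * (l2_norm x)\<^sup>2 + t * (l2_norm y)\<^sup>2"
    using assms by (simp add: l2_norm_append l2_norm_smult power_mult_distrib)
  also have "\<dots> \<le> s * 1 + t * 1"
    using assms by (intro add_mono mult_left_mono) (auto simp: power_le_one)
  finally show "(l2_norm (complex_of_real (sqrt s) \<cdot>\<^sub>v x @\<^sub>v complex_of_real (sqrt t) \<cdot>\<^sub>v y))\<^sup>2 \<le> 1\<^sup>2"
    using assms by simp
qed simp

text \<open>
  Direct sums turn convex combinations of moments into moments: with the weights \<open>\<surd>s\<close> and \<open>\<surd>t\<close> on
  the two summands the vectors stay in the unit ball.
\<close>

lemma convex_moment_range:
  assumes K: "matrix_convex K"
  shows "convex (moment_range K \<Lambda> p w)"
proof (rule convexI)
  fix z z' :: "complex \<times> complex" and s t :: real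
  assume z: "z \<in> moment_range K \<Lambda> p w" and z': "z' \<in> moment_range K \<Lambda> p w"
    and st: "0 \<le> s" "0 \<le> t" "s + t = 1"
  obtain n X x y where n: "1 \<le> n" "X \<in> K n" "nilpotent_wrt n (insert w \<Lambda>) X"
    and x: "x \<in> carrier_vec n" "y \<in> carrier_vec n" "l2_norm x \<le> 1" "l2_norm y \<le> 1"
    and zeq: "z = (\<Sum>v\<in>\<Lambda>. p v * moment n X x y v, moment n X x y w)"
    using z unfolding moment_range_def by blast
  obtain m Y x' y' where m: "1 \<le> m" "Y \<in> K m" "nilpotent_wrt m (insert w \<Lambda>) Y"
    and x': "x' \<in> carrier_vec m" "y' \<in> carrier_vec m" "l2_norm x' \<le> 1" "l2_norm y' \<le> 1"
    and zeq': "z' = (\<Sum>v\<in>\<Lambda>. p v * moment m Y x' y' v, moment m Y x' y' w)"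
    using z' unfolding moment_range_def by blast
  note X = matrix_convex_mtuples[OF K n(1,2)] and Y = matrix_convex_mtuples[OF K m(1,2)]
  define \<sigma> \<tau> where "\<sigma> = complex_of_real (sqrt s)" and "\<tau> = complex_of_real (sqrt t)"
  have sq: "\<sigma> * cnj \<sigma> = complex_of_real s" "\<tau> * cnj \<tau> = complex_of_real t"
    using st by (simp_all add: \<sigma>_def \<tau>_def flip: of_real_mult)
  let ?x = "\<sigma> \<cdot>\<^sub>v x @\<^sub>v \<tau> \<cdot>\<^sub>v x'" and ?y = "\<sigma> \<cdot>\<^sub>v y @\<^sub>v \<tau> \<cdot>\<^sub>v y'"
  have mom: "moment (n + m) (direct_sum X Y) ?x ?y v
      = complex_of_real s * moment n X x y v + complex_of_real t * moment m Y x' y' v" for v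
    using x x' by (simp add: moment_direct_sum[OF X Y] moment_smult[OF X] moment_smult[OF Y] sq)
  have eq: "s *\<^sub>R z + t *\<^sub>R z' = (\<Sum>v\<in>\<Lambda>. p v * moment (n + m) (direct_sum X Y) ?x ?y v,
      moment (n + m) (direct_sum X Y) ?x ?y w)"
    unfolding zeq zeq' mom
    by (simp add: scaleR_conv_of_real distrib_left sum.distrib sum_distrib_left mult.left_commute)
  have "1 \<le> n + m" "direct_sum X Y \<in> K (n + m)"
    "nilpotent_wrt (n + m) (insert w \<Lambda>) (direct_sum X Y)"
    "?x \<in> carrier_vec (n + m)" "?y \<in> carrier_vec (n + m)" "l2_norm ?x \<le> 1" "l2_norm ?y \<le> 1"
    using n m x x' st matrix_convex_direct_sum[OF K n(1) m(1) n(2) m(2)]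
      nilpotent_direct_sum[OF X Y n(3) m(3)]
    unfolding \<sigma>_def \<tau>_def by (auto intro!: l2_norm_convex_append)
  thus "s *\<^sub>R z + t *\<^sub>R z' \<in> moment_range K \<Lambda> p w"
    unfolding eq by (rule moment_rangeI)
qed

lemma circled_moment_range:
  assumes K: "matrix_convex K" and "(a, b) \<in> moment_range K \<Lambda> p w" and u: "cmod u \<le> 1"
  shows "(u * a, u * b) \<in> moment_range K \<Lambda> p w"
proof -
  obtain n X x y where n: "1 \<le> n" "X \<in> K n" "nilpotent_wrt n (insert w \<Lambda>) X"
    and x: "x \<in> carrier_vec n" "y \<in> carrier_vec n" "l2_norm x \<le> 1" "l2_norm y \<le> 1"
    and ab: "a = (\<Sum>v\<in>\<Lambda>. p v * moment n X x y v)" "b = moment n X x y w"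
    using assms(2) unfolding moment_range_def by blast
  note X = matrix_convex_mtuples[OF K n(1,2)]
  have mom: "moment n X (u \<cdot>\<^sub>v x) y v = u * moment n X x y v" for v
    using moment_smult[OF X x(1,2), of u 1] by simp
  have eq: "(u * a, u * b) = (\<Sum>v\<in>\<Lambda>. p v * moment n X (u \<cdot>\<^sub>v x) y v, moment n X (u \<cdot>\<^sub>v x) y w)"
    unfolding mom ab by (simp add: sum_distrib_left mult.left_commute)
  have "u \<cdot>\<^sub>v x \<in> carrier_vec n" "l2_norm (u \<cdot>\<^sub>v x) \<le> 1"
    using x u by (auto simp: l2_norm_smult intro: mult_le_one)
  thus ?thesis unfolding eq using n x by (intro moment_rangeI) auto
qed

lemma contractive_on_insert:
  assumes K: "matrix_convex K" and \<Lambda>: "finite \<Lambda>" "initial_segment \<Lambda>" and w: "w \<notin> \<Lambda>"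
    and p: "contractive_on K \<Lambda> p"
  obtains c where "contractive_on K (insert w \<Lambda>) (p(w := c))"
proof -
  have slice: "cmod a \<le> 1" if a: "(a, 0) \<in> moment_range K \<Lambda> p w" for a
  proof -
    obtain n X x y where n: "1 \<le> n" "X \<in> K n" "nilpotent_wrt n (insert w \<Lambda>) X"
      and x: "x \<in> carrier_vec n" "y \<in> carrier_vec n" "l2_norm x \<le> 1" "l2_norm y \<le> 1"
      and ab: "a = (\<Sum>v\<in>\<Lambda>. p v * moment n X x y v)" "0 = moment n X x y w"
      using a unfolding moment_range_def by blast
    show ?thesis unfolding ab(1)
      by (rule contractive_at_vanishing_moment[OF K p \<Lambda>(2) w n x ab(2)[symmetric]])
  qed
  obtain c where c: "\<And>a b. (a, b) \<in> moment_range K \<Lambda> p w \<Longrightarrow> cmod (a + c * b) \<le> 1"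
    using circled_convex_separation[OF convex_moment_range[OF K] circled_moment_range[OF K] slice]
    by blast
  show ?thesis
  proof (rule that[of c])
    show "contractive_on K (insert w \<Lambda>) (p(w := c))"
      unfolding contractive_on_def
    proof (intro allI ballI impI)
      fix n X x y assume *: "1 \<le> n" "X \<in> K n" "nilpotent_wrt n (insert w \<Lambda>) X"
        "x \<in> carrier_vec n" "y \<in> carrier_vec n" "l2_norm x \<le> 1" "l2_norm y \<le> 1"
      have "(\<Sum>v\<in>insert w \<Lambda>. (p(w := c)) v * moment n X x y v)
          = c * moment n X x y w + (\<Sum>v\<in>\<Lambda>. (p(w := c)) v * moment n X x y v)"
        using \<Lambda>(1) w by simp
      also have "(\<Sum>v\<in>\<Lambda>. (p(w := c)) v * moment n X x y v) = (\<Sum>v\<in>\<Lambda>. p v * moment n X x y v)"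
        using w by (intro sum.cong) auto
      finally have eq: "(\<Sum>v\<in>insert w \<Lambda>. (p(w := c)) v * moment n X x y v)
          = (\<Sum>v\<in>\<Lambda>. p v * moment n X x y v) + c * moment n X x y w" by simp
      have "(\<Sum>v\<in>\<Lambda>. p v * moment n X x y v, moment n X x y w) \<in> moment_range K \<Lambda> p w"
        using * by (intro moment_rangeI)
      from c[OF this] show "cmod (\<Sum>v\<in>insert w \<Lambda>. (p(w := c)) v * moment n X x y v) \<le> 1"
        unfolding eq .
    qed
  qed
qed

section \<open>Extending the coefficients to all words\<close>

lemma initial_segment_insert_shortest:
  assumes "initial_segment \<Lambda>" "w \<notin> \<Lambda>" "\<And>v. v \<notin> \<Lambda> \<Longrightarrow> length w \<le> length v"
  shows "initial_segment (insert w \<Lambda>)"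
  unfolding initial_segment_def
proof (intro allI impI)
  fix v and j :: 'a assume v: "v \<notin> insert w \<Lambda>"
  hence "length w \<le> length v" using assms(3) by simp
  hence "j # v \<noteq> w" "v @ [j] \<noteq> w" by auto
  thus "j # v \<notin> insert w \<Lambda> \<and> v @ [j] \<notin> insert w \<Lambda>"
    using v assms(1) unfolding initial_segment_def by auto
qed

lemma infinite_words: "infinite (UNIV :: 'd list set)"
  by (rule infinite_UNIV_listI)

lemma finite_words_length: "finite {w :: ('d :: finite) list. length w = k}"
  using finite_lists_length_eq[of "UNIV :: 'd set" k] by simp

lemma finite_words_length_less: "finite {w :: ('d :: finite) list. length w < k}"
  by (rule finite_subset[OF _ finite_lists_length_le[of "UNIV :: 'd set" k]]) auto

text \<open>
  A word of minimal length outside an initial segment can be adjoined to it, and repeating this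
  exhausts all words, since there are only finitely many of each length. The coefficients are
  chosen one after the other.
\<close>

lemma contractive_extension:
  fixes K :: "nat \<Rightarrow> ('d :: finite) mtuple set"
  assumes K: "matrix_convex K" and \<Lambda>: "finite \<Lambda>" "initial_segment \<Lambda>" and p: "contractive_on K \<Lambda> p"
  obtains f where "\<And>w. w \<in> \<Lambda> \<Longrightarrow> f w = p w"
    "\<And>m. \<exists>S. finite S \<and> {w. length w < m} \<subseteq> S \<and> contractive_on K S f"
proof -
  define P where "P = (\<lambda>(k :: nat) (S, q). finite S \<and> initial_segment S \<and> contractive_on K S q)"
  define Q where "Q = (\<lambda>(k :: nat) (S, q) (S', q' :: 'd nc_series).
    \<exists>w. w \<notin> S \<and> (\<forall>v. v \<notin> S \<longrightarrow> length w \<le> length v) \<and> S' = insert w S \<and> (\<forall>v\<in>S. q' v = q v))"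
  have "\<exists>F. F 0 = (\<Lambda>, p) \<and> (\<forall>k. P k (F k) \<and> Q k (F k) (F (Suc k)))"
  proof -
    have step: "\<exists>y. P (Suc k) y \<and> Q k x y" if Px: "P k x" for k x
    proof -
      obtain S q where xS: "x = (S, q)" by (cases x)
      have S: "finite S" "initial_segment S" "contractive_on K S q"
        using Px by (auto simp: P_def xS)
      have "\<exists>v. v \<notin> S" using S(1) infinite_words ex_new_if_finite by metis
      then obtain w where w: "w \<notin> S" "\<And>v. v \<notin> S \<Longrightarrow> length w \<le> length v"
        using ex_has_least_nat[of "\<lambda>v. v \<notin> S" _ length] by blast
      obtain c where c: "contractive_on K (insert w S) (q(w := c))"
        by (rule contractive_on_insert[OF K S(1,2) w(1) S(3)])
      have "P (Suc k) (insert w S, q(w := c))"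
        using c S initial_segment_insert_shortest[OF S(2) w] by (simp add: P_def)
      moreover have "Q k x (insert w S, q(w := c))"
        using w by (auto simp: Q_def xS)
      ultimately show ?thesis by blast
    qed
    have "P 0 (\<Lambda>, p)" using \<Lambda> p by (simp add: P_def)
    define P' where "P' = (\<lambda>k x. P k x \<and> (k = 0 \<longrightarrow> x = (\<Lambda>, p)))"
    have "\<exists>x. P' 0 x" using \<open>P 0 (\<Lambda>, p)\<close> by (auto simp: P'_def)
    moreover have "\<exists>y. P' (Suc k) y \<and> Q k x y" if "P' k x" for k x
      using step[of k x] that by (simp add: P'_def)
    ultimately have "\<exists>F. \<forall>k. P' k (F k) \<and> Q k (F k) (F (Suc k))"
      by (rule dependent_nat_choice)
    thus ?thesis by (auto simp: P'_def)
  qed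
  then obtain F where F0: "F 0 = (\<Lambda>, p)" and FP: "\<And>k. P k (F k)" and FQ: "\<And>k. Q k (F k) (F (Suc k))"
    by blast
  define S q where "S k = fst (F k)" and "q k = snd (F k)" for k
  have S: "finite (S k)" "contractive_on K (S k) (q k)" for k
    using FP[of k] by (auto simp: P_def S_def q_def split: prod.splits)
  have SQ: "\<exists>w. w \<notin> S k \<and> (\<forall>v. v \<notin> S k \<longrightarrow> length w \<le> length v) \<and> S (Suc k) = insert w (S k)"
    and qS: "\<And>v. v \<in> S k \<Longrightarrow> q (Suc k) v = q k v" for k
    using FQ[of k] by (auto simp: Q_def S_def q_def split: prod.splits)
  have mono: "S k \<subseteq> S (k + i)" for k i
  proof (induction i)
    case (Suc i) thus ?case using SQ[of "k + i"] by auto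
  qed simp
  have qmono: "q (k + i) v = q k v" if "v \<in> S k" for k i v
  proof (induction i)
    case (Suc i) thus ?case using qS[of v "k + i"] mono[of k i] that by auto
  qed simp
  have exhaust: "\<exists>k. v \<in> S k" for v
  proof (rule ccontr)
    assume v: "\<nexists>k. v \<in> S k"
    \<comment> \<open>Every adjoined word is shortest possible, hence at most as long as \<open>v\<close>.\<close>
    have card: "card {w \<in> S k. length w \<le> length v} \<ge> k" for k
    proof (induction k)
      case (Suc k)
      obtain w where w: "w \<notin> S k" "\<forall>v. v \<notin> S k \<longrightarrow> length w \<le> length v" "S (Suc k) = insert w (S k)"
        using SQ by blast
      have "{u \<in> S (Suc k). length u \<le> length v} = insert w {u \<in> S k. length u \<le> length v}"
        using w v by auto
      thus ?case using Suc w(1) S(1)[of k] by simp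
    qed simp
    let ?N = "card {w :: 'd list. length w < Suc (length v)}"
    have "Suc ?N \<le> card {w \<in> S (Suc ?N). length w \<le> length v}" by (rule card)
    also have "\<dots> \<le> ?N"
      by (rule card_mono[OF finite_words_length_less]) auto
    finally show False by simp
  qed
  define f where "f v = q (LEAST k. v \<in> S k) v" for v
  have fq: "f v = q k v" if v: "v \<in> S k" for v k
  proof -
    let ?l = "LEAST k. v \<in> S k"
    have "v \<in> S ?l" using v by (rule LeastI)
    moreover have "?l \<le> k" using v by (rule Least_le)
    ultimately show ?thesis using qmono[of v ?l "k - ?l"] by (simp add: f_def)
  qed
  show ?thesis
  proof (rule that[of f])
    fix w assume "w \<in> \<Lambda>"
    thus "f w = p w" using fq[of w 0] by (simp add: S_def q_def F0)
  next
    fix m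
    have "finite B \<Longrightarrow> \<exists>k. B \<subseteq> S k" for B
    proof (induction B rule: finite_induct)
      case (insert v B)
      then obtain k l where "B \<subseteq> S k" "v \<in> S l" using exhaust by blast
      thus ?case using mono[of k l] mono[of l k] by (intro exI[of _ "k + l"]) (auto simp: add.commute)
    qed simp
    from this[OF finite_words_length_less[of m]] obtain k where k: "{w. length w < m} \<subseteq> S k" by blast
    have "contractive_on K (S k) f"
      using S(2)[of k] unfolding contractive_on_def by (simp add: fq cong: sum.cong)
    thus "\<exists>S. finite S \<and> {w. length w < m} \<subseteq> S \<and> contractive_on K S f"
      using k S(1) by blast
  qed
qed

section \<open>Tensoring with a nilpotent shift\<close>

text \<open>
  A finite sum of compressions of points of \<open>K\<close> is a single compression of their direct sum.
\<close>

lemma direct_sum_of_family: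
  fixes a :: "nat \<Rightarrow> nat \<Rightarrow> complex vec"
  assumes K: "matrix_convex K" and n: "1 \<le> n" and X: "\<And>k. k \<le> M \<Longrightarrow> X k \<in> K n"
    and a: "\<And>k i. a k i \<in> carrier_vec n"
  obtains L Y c where "1 \<le> L" "Y \<in> K L" "\<And>i. c i \<in> carrier_vec L"
    "\<And>i j. c j \<bullet>c c i = (\<Sum>k\<le>M. a k j \<bullet>c a k i)"
    "\<And>p i j. (Y p *\<^sub>v c j) \<bullet>c c i = (\<Sum>k\<le>M. (X k p *\<^sub>v a k j) \<bullet>c a k i)"
  using X
proof (induction M arbitrary: thesis)
  case 0
  have "X 0 \<in> K n" by (rule 0(2)) simp
  from 0(1)[of n "X 0" "a 0", OF n this] show ?case using a by simp
next
  case (Suc M)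
  have XM: "X k \<in> K n" if "k \<le> M" for k by (rule Suc.prems(2)) (use that in simp)
  obtain L Y c where L: "1 \<le> L" and Y: "Y \<in> K L" and c: "\<And>i. c i \<in> carrier_vec L"
    and cc: "\<And>i j. c j \<bullet>c c i = (\<Sum>k\<le>M. a k j \<bullet>c a k i)"
    and Yc: "\<And>p i j. (Y p *\<^sub>v c j) \<bullet>c c i = (\<Sum>k\<le>M. (X k p *\<^sub>v a k j) \<bullet>c a k i)"
    by (rule Suc.IH[OF _ XM]) (rule that)
  let ?Z = "X (Suc M)" and ?b = "a (Suc M)"
  have Z: "?Z \<in> K n" by (rule Suc.prems(2)) simp
  note Yt = matrix_convex_mtuples[OF K L Y] and Zt = matrix_convex_mtuples[OF K n Z]
  have Yp: "Y p \<in> carrier_mat L L" and Zp: "?Z p \<in> carrier_mat n n" for p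
    using Yt Zt by (auto simp: mtuples_def)
  show ?case
  proof (rule Suc.prems(1)[of "L + n" "direct_sum Y ?Z" "\<lambda>i. c i @\<^sub>v ?b i"])
    show "1 \<le> L + n" using L by simp
    show "direct_sum Y ?Z \<in> K (L + n)" by (rule matrix_convex_direct_sum[OF K L n Y Z])
    show "c i @\<^sub>v ?b i \<in> carrier_vec (L + n)" for i
      by (rule append_carrier_vec[OF c a])
    show "(c j @\<^sub>v ?b j) \<bullet>c (c i @\<^sub>v ?b i) = (\<Sum>k\<le>Suc M. a k j \<bullet>c a k i)" for i j
      unfolding cscalar_append[OF c c a a] cc sum.atMost_Suc ..
    show "(direct_sum Y ?Z p *\<^sub>v (c j @\<^sub>v ?b j)) \<bullet>c (c i @\<^sub>v ?b i)
        = (\<Sum>k\<le>Suc M. (X k p *\<^sub>v a k j) \<bullet>c a k i)" for p i j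
      unfolding direct_sum_mult_vec[OF Yt Zt c a]
        cscalar_append[OF mult_mat_vec_carrier[OF Yp c] c mult_mat_vec_carrier[OF Zp a] a] Yc
        sum.atMost_Suc ..
  qed
qed

lemma sum_roots_of_unity:
  fixes d :: int
  assumes d: "\<bar>d\<bar> \<le> int m"
  shows "(\<Sum>k\<le>m. cis (2 * pi * real k * of_int d / real (Suc m))) = (if d = 0 then of_nat (Suc m) else 0)"
proof (cases "d = 0")
  case False
  define z where "z = cis (2 * pi * of_int d / real (Suc m))"
  have pow: "z ^ k = cis (2 * pi * real k * of_int d / real (Suc m))" for k
    unfolding z_def DeMoivre by (simp add: ac_simps)
  have cancel: "x = y * q" if "2 * pi * x / q = y * 2 * pi" "q > 0" for x y q :: real
  proof -
    have "2 * pi * x = y * 2 * pi * q" using that by (subst (asm) nonzero_divide_eq_eq) auto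
    hence "(2 * pi) * x = (2 * pi) * (y * q)" by (simp only: mult.assoc mult.left_commute)
    thus ?thesis by simp
  qed
  have "z \<noteq> 1"
  proof
    assume "z = 1"
    hence "cos (2 * pi * of_int d / real (Suc m)) = 1" by (simp add: z_def complex_eq_iff)
    then obtain l :: int where "2 * pi * of_int d / real (Suc m) = of_int l * 2 * pi"
      using cos_one_2pi_int by auto
    from cancel[OF this] have "of_int d = of_int l * real (Suc m)" by simp
    also have "\<dots> = of_int (l * int (Suc m))" by simp
    finally have dl: "d = l * int (Suc m)" by (simp only: of_int_eq_iff)
    hence "l \<noteq> 0" using False by auto
    hence "int (Suc m) \<le> \<bar>l\<bar> * int (Suc m)" by (simp add: mult_le_cancel_right1)
    also have "\<dots> = \<bar>d\<bar>" unfolding dl by (simp add: abs_mult)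
    finally show False using d by simp
  qed
  moreover have "z ^ Suc m = 1"
  proof -
    have "2 * pi * real (Suc m) * of_int d / real (Suc m) = 2 * pi * of_int d"
      by (simp del: of_nat_Suc)
    thus ?thesis unfolding pow using cis_multiple_2pi[OF Ints_of_int, of d] by (simp only:)
  qed
  ultimately have "(\<Sum>k<Suc m. z ^ k) = 0" by (subst geometric_sum) auto
  thus ?thesis using False by (simp add: pow lessThan_Suc_atMost del: sum.lessThan_Suc)
qed simp

text \<open>
  The tuple \<open>X \<otimes> S\<close>, where \<open>S\<close> is the nilpotent shift on \<open>\<complex>\<^sup>m\<close>: in blocks of size \<open>n\<close>, the
  matrices \<open>X p\<close> stand on the subdiagonal.
\<close>

definition shift_tuple :: "nat \<Rightarrow> nat \<Rightarrow> 'd mtuple \<Rightarrow> 'd mtuple" where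
  "shift_tuple n m X = (\<lambda>p. mat (n * m) (n * m)
     (\<lambda>(i, j). if i div n = Suc (j div n) then X p $$ (i mod n, j mod n) else 0))"

text \<open>
  The nilpotent shift on \<open>\<complex>\<^sup>m\<close> is a compression of the cyclic permutation of order \<open>m + 1\<close>, and the
  Fourier transform of order \<open>m + 1\<close> diagonalises that permutation. Hence \<open>X \<otimes> S\<close> is a
  compression of the direct sum of the rotated tuples \<open>cis (2 \<pi> k / (m + 1)) X\<close> for \<open>k = 0, \<dots>, m\<close>,
  which lie in \<open>K\<close> because \<open>K\<close> is circled. The order exceeds \<open>m\<close> so that the matrix entry that closes
  the cycle falls outside the compression.
\<close>

lemma shift_tuple_mem:
  assumes K: "matrix_convex K" and circ: "circled K" and n: "1 \<le> n" and m: "1 \<le> m" and X: "X \<in> K n"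
  shows "shift_tuple n m X \<in> K (n * m)"
proof -
  define \<theta> where "\<theta> k = 2 * pi * real k / real (Suc m)" for k
  define N where "N = complex_of_real (1 / sqrt (real (Suc m)))"
  define Z where "Z k = (\<lambda>p. cis (\<theta> k) \<cdot>\<^sub>m X p)" for k
  \<comment> \<open>The component of the \<open>i\<close>-th column of the isometry in the \<open>k\<close>-th summand: a discrete Fourier
    transform in the block index \<open>i div n\<close>, the identity in \<open>i mod n\<close>.\<close>
  define a where "a k i = (N * cis (\<theta> k * real (i div n))) \<cdot>\<^sub>v unit_vec n (i mod n)" for k i
  have Xp: "X p \<in> carrier_mat n n" for p
    using matrix_convex_mtuples[OF K n X] by (simp add: mtuples_def)
  have Z: "Z k \<in> K n" for k
    using circ n X unfolding circled_def Z_def by blast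
  have ac: "a k i \<in> carrier_vec n" for k i by (simp add: a_def)
  have mod: "i mod n < n" for i using n by simp
  have NN: "N * cnj N = 1 / of_nat (Suc m)"
    by (simp add: N_def flip: of_real_mult)
  have sm: "(b \<cdot>\<^sub>v x) \<bullet>c (c \<cdot>\<^sub>v y) = b * cnj c * (x \<bullet>c y)"
    if "x \<in> carrier_vec n" "y \<in> carrier_vec n" for b c :: complex and x y
  proof -
    have "c \<cdot>\<^sub>v y \<in> carrier_vec n" using that by simp
    thus ?thesis using that
      by (simp add: cscalar_sum_carrier[of _ n] sum_distrib_left mult.assoc mult.left_commute)
  qed
  have phase: "N * cis (\<theta> k * real (j div n)) * cnj (N * cis (\<theta> k * real (i div n)))
      = cis (2 * pi * real k * of_int (int (j div n) - int (i div n)) / real (Suc m)) / of_nat (Suc m)" for k i j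
  proof -
    have "N * cis (\<theta> k * real (j div n)) * cnj (N * cis (\<theta> k * real (i div n)))
      = (N * cnj N) * (cis (\<theta> k * real (j div n)) * cis (- (\<theta> k * real (i div n))))"
      by (simp add: cis_cnj)
    also have "cis (\<theta> k * real (j div n)) * cis (- (\<theta> k * real (i div n)))
        = cis (2 * pi * real k * of_int (int (j div n) - int (i div n)) / real (Suc m))"
      unfolding cis_mult by (rule arg_cong[of _ _ cis]) (simp add: \<theta>_def field_simps del: of_nat_Suc)
    finally show ?thesis unfolding NN by simp
  qed
  obtain L Y c where L: "1 \<le> L" and Y: "Y \<in> K L" and c: "\<And>i. c i \<in> carrier_vec L"
    and cc: "\<And>i j. c j \<bullet>c c i = (\<Sum>k\<le>m. a k j \<bullet>c a k i)"
    and Yc: "\<And>p i j. (Y p *\<^sub>v c j) \<bullet>c c i = (\<Sum>k\<le>m. (Z k p *\<^sub>v a k j) \<bullet>c a k i)"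
    by (rule direct_sum_of_family[where X = Z and a = a and M = m, OF K n Z ac]) (rule that)
  have nm: "1 \<le> n * m" using n m by simp
  have divm: "i div n < m" if "i < n * m" for i
    using that by (simp add: less_mult_imp_div_less mult.commute)
  have "(\<lambda>p. mat (n * m) (n * m) (\<lambda>(i, j). (Y p *\<^sub>v c j) \<bullet>c c i)) \<in> K (n * m)"
  proof (rule compression_to_orthonormal_family[OF K L nm Y c])
    fix i j assume i: "i < n * m" and j: "j < n * m"
    let ?d = "int (j div n) - int (i div n)"
    have "c j \<bullet>c c i = (\<Sum>k\<le>m. cis (2 * pi * real k * of_int ?d / real (Suc m)) / of_nat (Suc m)
        * (unit_vec n (j mod n) \<bullet>c unit_vec n (i mod n)))"
      unfolding cc a_def by (subst sm) (auto simp only: unit_vec_carrier phase)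
    also have "\<dots> = (\<Sum>k\<le>m. cis (2 * pi * real k * of_int ?d / real (Suc m))) / of_nat (Suc m)
        * (unit_vec n (j mod n) \<bullet>c unit_vec n (i mod n))"
      unfolding sum_divide_distrib sum_distrib_right ..
    also have "(\<Sum>k\<le>m. cis (2 * pi * real k * of_int ?d / real (Suc m))) = (if ?d = 0 then of_nat (Suc m) else 0)"
      using divm[OF i] divm[OF j] by (intro sum_roots_of_unity) auto
    also have "(unit_vec n (j mod n) :: complex vec) \<bullet>c unit_vec n (i mod n) = (if i mod n = j mod n then 1 else 0)"
      by (subst cscalar_unit_vec) (auto simp: mod)
    also have "(if ?d = 0 then of_nat (Suc m) else 0) / of_nat (Suc m) * (if i mod n = j mod n then 1 else 0)
        = (if i = j then 1 else 0 :: complex)"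
    proof (cases "i = j")
      case False
      hence "i div n \<noteq> j div n \<or> i mod n \<noteq> j mod n" by (metis div_mult_mod_eq)
      thus ?thesis using False by auto
    qed (simp del: of_nat_Suc)
    finally show "c j \<bullet>c c i = (if i = j then 1 else 0)" .
  qed
  moreover have "mat (n * m) (n * m) (\<lambda>(i, j). (Y p *\<^sub>v c j) \<bullet>c c i) = shift_tuple n m X p" for p
  proof (rule eq_matI)
    fix i j assume "i < dim_row (shift_tuple n m X p)" "j < dim_col (shift_tuple n m X p)"
    hence i: "i < n * m" and j: "j < n * m" by (auto simp: shift_tuple_def)
    let ?d = "int (j div n) - int (i div n)" and ?x = "X p $$ (i mod n, j mod n)"
    have summand: "(Z k p *\<^sub>v a k j) \<bullet>c a k i
        = cis (2 * pi * real k * of_int (?d + 1) / real (Suc m)) / of_nat (Suc m) * ?x" for k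
    proof -
      have "(Z k p *\<^sub>v a k j) \<bullet>c a k i = cis (\<theta> k) * ((X p *\<^sub>v a k j) \<bullet>c a k i)"
        unfolding Z_def by (rule smult_form[OF Xp ac ac])
      also have "X p *\<^sub>v a k j = (N * cis (\<theta> k * real (j div n))) \<cdot>\<^sub>v (X p *\<^sub>v unit_vec n (j mod n))"
        unfolding a_def by (rule mult_mat_vec[OF Xp]) simp
      also have "\<dots> \<bullet>c a k i = N * cis (\<theta> k * real (j div n)) * cnj (N * cis (\<theta> k * real (i div n)))
          * ((X p *\<^sub>v unit_vec n (j mod n)) \<bullet>c unit_vec n (i mod n))"
        unfolding a_def by (rule sm) (auto intro: mult_mat_vec_carrier[OF Xp])
      also have "(X p *\<^sub>v unit_vec n (j mod n)) \<bullet>c unit_vec n (i mod n) = ?x"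
        by (rule entry_form[OF Xp mod mod])
      also have "cis (\<theta> k) * (N * cis (\<theta> k * real (j div n)) * cnj (N * cis (\<theta> k * real (i div n))) * ?x)
          = cis (\<theta> k) * cis (2 * pi * real k * of_int ?d / real (Suc m)) / of_nat (Suc m) * ?x"
        unfolding phase by simp
      also have "cis (\<theta> k) * cis (2 * pi * real k * of_int ?d / real (Suc m))
          = cis (2 * pi * real k * of_int (?d + 1) / real (Suc m))"
        unfolding cis_mult by (rule arg_cong[of _ _ cis]) (simp add: \<theta>_def field_simps del: of_nat_Suc)
      finally show ?thesis .
    qed
    have "(Y p *\<^sub>v c j) \<bullet>c c i
        = (\<Sum>k\<le>m. cis (2 * pi * real k * of_int (?d + 1) / real (Suc m))) / of_nat (Suc m) * ?x"
      unfolding Yc summand sum_divide_distrib sum_distrib_right ..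
    also have "(\<Sum>k\<le>m. cis (2 * pi * real k * of_int (?d + 1) / real (Suc m)))
        = (if ?d + 1 = 0 then of_nat (Suc m) else 0)"
      using divm[OF i] divm[OF j] by (intro sum_roots_of_unity) auto
    also have "(if ?d + 1 = 0 then of_nat (Suc m) else 0) / of_nat (Suc m) * ?x
        = (if i div n = Suc (j div n) then ?x else 0)"
      by (simp del: of_nat_Suc)
    finally show "mat (n * m) (n * m) (\<lambda>(i, j). (Y p *\<^sub>v c j) \<bullet>c c i) $$ (i, j) = shift_tuple n m X p $$ (i, j)"
      using i j by (simp add: shift_tuple_def)
  qed (auto simp: shift_tuple_def)
  ultimately show ?thesis by simp
qed

definition block_vec :: "nat \<Rightarrow> nat \<Rightarrow> (nat \<Rightarrow> complex vec) \<Rightarrow> complex vec" where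
  "block_vec n m v = vec (n * m) (\<lambda>i. v (i div n) $ (i mod n))"

lemma block_vec_carrier [simp]: "block_vec n m v \<in> carrier_vec (n * m)"
  by (simp add: block_vec_def)

lemma sum_blocks:
  fixes n m :: nat and g :: "nat \<Rightarrow> nat \<Rightarrow> complex"
  assumes n: "1 \<le> n"
  shows "(\<Sum>i<n * m. g (i div n) (i mod n)) = (\<Sum>b<m. \<Sum>r<n. g b r)"
proof -
  have "(\<Sum>b<m. \<Sum>r<n. g b r) = (\<Sum>(b, r)\<in>{..<m} \<times> {..<n}. g b r)"
    by (rule sum.cartesian_product)
  also have "\<dots> = (\<Sum>i<n * m. g (i div n) (i mod n))"
  proof (rule sum.reindex_bij_witness[of _ "\<lambda>i. (i div n, i mod n)" "\<lambda>(b, r). b * n + r"])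
    fix z assume z: "z \<in> {..<m} \<times> {..<n}"
    then obtain b r where br: "z = (b, r)" "b < m" "r < n" by auto
    have "b * n + r < Suc b * n" using br by simp
    also have "\<dots> \<le> m * n" using br by (intro mult_le_mono1) simp
    finally show "(case z of (b, r) \<Rightarrow> b * n + r) \<in> {..<n * m}" using br by (simp add: mult.commute)
  qed (use n in \<open>auto simp: less_mult_imp_div_less mult.commute\<close>)
  finally show ?thesis ..
qed

lemma block_vec_decompose:
  assumes n: "1 \<le> n" and x: "x \<in> carrier_vec (n * m)"
  obtains v where "\<And>b. v b \<in> carrier_vec n" "x = block_vec n m v"
proof (rule that[of "\<lambda>b. vec n (\<lambda>r. x $ (b * n + r))"])
  show "x = block_vec n m (\<lambda>b. vec n (\<lambda>r. x $ (b * n + r)))"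
    using n x by (intro eq_vecI) (auto simp: block_vec_def)
qed simp

lemma cscalar_block_vec:
  assumes n: "1 \<le> n" and u: "\<And>b. b < m \<Longrightarrow> u b \<in> carrier_vec n"
  shows "block_vec n m v \<bullet>c block_vec n m u = (\<Sum>b<m. v b \<bullet>c u b)"
proof -
  have "block_vec n m v \<bullet>c block_vec n m u = (\<Sum>i<n * m. v (i div n) $ (i mod n) * cnj (u (i div n) $ (i mod n)))"
    unfolding cscalar_sum_carrier[OF block_vec_carrier] by (intro sum.cong refl) (simp add: block_vec_def)
  also have "\<dots> = (\<Sum>b<m. \<Sum>r<n. v b $ r * cnj (u b $ r))"
    by (rule sum_blocks[OF n])
  also have "\<dots> = (\<Sum>b<m. v b \<bullet>c u b)"
    by (intro sum.cong refl cscalar_sum_carrier[symmetric] u) simp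
  finally show ?thesis .
qed

lemma l2_norm_block_vec:
  assumes n: "1 \<le> n" and u: "\<And>b. b < m \<Longrightarrow> u b \<in> carrier_vec n"
  shows "(l2_norm (block_vec n m u))\<^sup>2 = (\<Sum>b<m. (l2_norm (u b))\<^sup>2)"
proof -
  have "complex_of_real ((l2_norm (block_vec n m u))\<^sup>2) = complex_of_real (\<Sum>b<m. (l2_norm (u b))\<^sup>2)"
    unfolding cscalar_self[symmetric] of_real_sum by (rule cscalar_block_vec[OF n u])
  thus ?thesis unfolding of_real_eq_iff .
qed

lemma shift_tuple_mtuples [simp]: "shift_tuple n m X \<in> mtuples (n * m)"
  by (simp add: mtuples_def shift_tuple_def)

lemma shift_tuple_mult_block_vec:
  assumes n: "1 \<le> n" and X: "X \<in> mtuples n" and v: "\<And>b. v b \<in> carrier_vec n"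
  shows "shift_tuple n m X p *\<^sub>v block_vec n m v
    = block_vec n m (\<lambda>b. if b = 0 then 0\<^sub>v n else X p *\<^sub>v v (b - 1))"
proof (rule eq_vecI)
  fix i assume "i < dim_vec (block_vec n m (\<lambda>b. if b = 0 then 0\<^sub>v n else X p *\<^sub>v v (b - 1)))"
  hence i: "i < n * m" by (simp add: block_vec_def)
  have Xp: "X p \<in> carrier_mat n n" using X by (simp add: mtuples_def)
  have S: "shift_tuple n m X p \<in> carrier_mat (n * m) (n * m)" by (simp add: shift_tuple_def)
  have mod: "i mod n < n" using n by simp
  have div: "i div n < m" using i by (simp add: less_mult_imp_div_less mult.commute)
  have "(shift_tuple n m X p *\<^sub>v block_vec n m v) $ i
      = (\<Sum>l<n * m. shift_tuple n m X p $$ (i, l) * block_vec n m v $ l)"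
    by (rule mult_mat_vec_index_sum[OF S block_vec_carrier i])
  also have "\<dots> = (\<Sum>l<n * m. (if i div n = Suc (l div n) then X p $$ (i mod n, l mod n) * v (l div n) $ (l mod n) else 0))"
    using i by (intro sum.cong refl) (simp add: shift_tuple_def block_vec_def)
  also have "\<dots> = (\<Sum>b<m. \<Sum>r<n. (if i div n = Suc b then X p $$ (i mod n, r) * v b $ r else 0))"
    by (rule sum_blocks[OF n])
  also have "\<dots> = (\<Sum>b<m. if i div n = Suc b then (X p *\<^sub>v v b) $ (i mod n) else 0)"
    by (intro sum.cong refl) (simp add: mult_mat_vec_index_sum[OF Xp v mod] del: index_mult_mat_vec)
  also have "\<dots> = (if i div n = 0 then 0 else (X p *\<^sub>v v (i div n - 1)) $ (i mod n))"
  proof (cases "i div n")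
    case (Suc c)
    have "(\<Sum>b<m. if Suc c = Suc b then (X p *\<^sub>v v b) $ (i mod n) else 0) = (X p *\<^sub>v v c) $ (i mod n)"
      using Suc div by simp
    thus ?thesis using Suc by simp
  qed simp
  also have "\<dots> = block_vec n m (\<lambda>b. if b = 0 then 0\<^sub>v n else X p *\<^sub>v v (b - 1)) $ i"
    using i mod by (simp add: block_vec_def)
  finally show "(shift_tuple n m X p *\<^sub>v block_vec n m v) $ i
      = block_vec n m (\<lambda>b. if b = 0 then 0\<^sub>v n else X p *\<^sub>v v (b - 1)) $ i" .
qed (simp add: shift_tuple_def block_vec_def)

lemma word_eval_shift_tuple:
  assumes n: "1 \<le> n" and X: "X \<in> mtuples n" and v: "\<And>b. v b \<in> carrier_vec n"
  shows "word_eval (n * m) (shift_tuple n m X) w *\<^sub>v block_vec n m v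
    = block_vec n m (\<lambda>b. if b < length w then 0\<^sub>v n else word_eval n X w *\<^sub>v v (b - length w))"
proof (induction w)
  case Nil thus ?case using v by simp
next
  case (Cons j w)
  let ?u = "\<lambda>b. if b < length w then 0\<^sub>v n else word_eval n X w *\<^sub>v v (b - length w)"
  have u: "?u b \<in> carrier_vec n" for b using word_eval_vec_carrier[OF X v] by simp
  have "word_eval (n * m) (shift_tuple n m X) (j # w) *\<^sub>v block_vec n m v = shift_tuple n m X j *\<^sub>v block_vec n m ?u"
    unfolding word_eval_Cons_mult_vec[OF shift_tuple_mtuples block_vec_carrier] Cons.IH ..
  also have "\<dots> = block_vec n m (\<lambda>b. if b = 0 then 0\<^sub>v n else X j *\<^sub>v ?u (b - 1))"
    by (rule shift_tuple_mult_block_vec[OF n X u])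
  also have "(\<lambda>b. if b = 0 then 0\<^sub>v n else X j *\<^sub>v ?u (b - 1))
      = (\<lambda>b. if b < length (j # w) then 0\<^sub>v n else word_eval n X (j # w) *\<^sub>v v (b - length (j # w)))"
  proof
    fix b
    have Xj: "X j \<in> carrier_mat n n" using X by (simp add: mtuples_def)
    show "(if b = 0 then 0\<^sub>v n else X j *\<^sub>v ?u (b - 1))
      = (if b < length (j # w) then 0\<^sub>v n else word_eval n X (j # w) *\<^sub>v v (b - length (j # w)))"
      unfolding word_eval_Cons_mult_vec[OF X v]
      by (cases b) (auto simp: mult_mat_zero_vec[OF Xj])
  qed
  finally show ?case .
qed

lemma moment_shift_tuple:
  assumes n: "1 \<le> n" and X: "X \<in> mtuples n"
    and v: "\<And>b. v b \<in> carrier_vec n" and u: "\<And>b. u b \<in> carrier_vec n"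
  shows "moment (n * m) (shift_tuple n m X) (block_vec n m v) (block_vec n m u) w
    = (\<Sum>b<m. if length w \<le> b then moment n X (v (b - length w)) (u b) w else 0)"
proof -
  have "moment (n * m) (shift_tuple n m X) (block_vec n m v) (block_vec n m u) w
      = (\<Sum>b<m. (if b < length w then 0\<^sub>v n else word_eval n X w *\<^sub>v v (b - length w)) \<bullet>c u b)"
    unfolding moment_def word_eval_shift_tuple[OF n X v] by (rule cscalar_block_vec[OF n u])
  also have "\<dots> = (\<Sum>b<m. if length w \<le> b then moment n X (v (b - length w)) (u b) w else 0)"
    using u by (intro sum.cong refl) (simp add: moment_def not_less)
  finally show ?thesis .
qed

lemma nilpotent_shift_tuple:
  assumes n: "1 \<le> n" and X: "X \<in> mtuples n" and S: "{w. length w < m} \<subseteq> S"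
  shows "nilpotent_wrt (n * m) S (shift_tuple n m X)"
  unfolding nilpotent_wrt_def word_eval_zero_iff_moments[OF shift_tuple_mtuples]
proof (intro allI impI ballI)
  fix w and x y :: "complex vec"
  assume w: "w \<notin> S" and x: "x \<in> carrier_vec (n * m)" and y: "y \<in> carrier_vec (n * m)"
  obtain v where v: "\<And>b. v b \<in> carrier_vec n" "x = block_vec n m v" by (rule block_vec_decompose[OF n x]) (rule that)
  obtain u where u: "\<And>b. u b \<in> carrier_vec n" "y = block_vec n m u" by (rule block_vec_decompose[OF n y]) (rule that)
  have "m \<le> length w" using w S by (auto simp: not_less[symmetric])
  thus "moment (n * m) (shift_tuple n m X) x y w = 0"
    unfolding v(2) u(2) moment_shift_tuple[OF n X v(1) u(1)] by (intro sum.neutral) auto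
qed

definition hom_moment :: "nat \<Rightarrow> 'd nc_series \<Rightarrow> 'd mtuple \<Rightarrow> complex vec \<Rightarrow> complex vec \<Rightarrow> nat \<Rightarrow> complex" where
  "hom_moment n f X x y j = (\<Sum>w\<in>{w. length w = j}. f w * moment n X x y w)"

text \<open>
  At the nilpotent point \<open>X \<otimes> S\<close> the series is a finite sum, namely the lower triangular block Toeplitz
  matrix whose \<open>j\<close>-th diagonal consists of copies of the homogeneous part of degree \<open>j\<close> of \<open>f\<close> at \<open>X\<close>.
  Contractivity of the coefficients says that this matrix is a contraction.
\<close>

lemma toeplitz_contractive:
  fixes K :: "nat \<Rightarrow> ('d :: finite) mtuple set"
  assumes K: "matrix_convex K" and circ: "circled K" and n: "1 \<le> n" and m: "1 \<le> m" and X: "X \<in> K n"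
    and S: "finite S" "{w. length w < m} \<subseteq> S" "contractive_on K S f"
    and v: "\<And>b. v b \<in> carrier_vec n" "(\<Sum>b<m. (l2_norm (v b))\<^sup>2) \<le> 1"
    and u: "\<And>b. u b \<in> carrier_vec n" "(\<Sum>b<m. (l2_norm (u b))\<^sup>2) \<le> 1"
  shows "cmod (\<Sum>b<m. \<Sum>j\<le>b. hom_moment n f X (v (b - j)) (u b) j) \<le> 1"
proof -
  note Xt = matrix_convex_mtuples[OF K n X]
  have nm: "1 \<le> n * m" using n m by simp
  have norm: "l2_norm (block_vec n m z) \<le> 1"
    if "\<And>b. z b \<in> carrier_vec n" "(\<Sum>b<m. (l2_norm (z b))\<^sup>2) \<le> 1" for z
  proof (rule power2_le_imp_le)
    show "(l2_norm (block_vec n m z))\<^sup>2 \<le> 1\<^sup>2"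
      unfolding l2_norm_block_vec[OF n that(1)] using that(2) by simp
  qed simp
  have "cmod (\<Sum>w\<in>S. f w * moment (n * m) (shift_tuple n m X) (block_vec n m v) (block_vec n m u) w) \<le> 1"
    by (rule contractive_onD[OF S(3) nm shift_tuple_mem[OF K circ n m X] nilpotent_shift_tuple[OF n Xt S(2)]
      block_vec_carrier block_vec_carrier norm[OF v] norm[OF u]])
  also have "(\<Sum>w\<in>S. f w * moment (n * m) (shift_tuple n m X) (block_vec n m v) (block_vec n m u) w)
      = (\<Sum>w\<in>S. \<Sum>b<m. if length w \<le> b then f w * moment n X (v (b - length w)) (u b) w else 0)"
    unfolding moment_shift_tuple[OF n Xt v(1) u(1)] sum_distrib_left by (intro sum.cong refl) simp
  also have "\<dots> = (\<Sum>b<m. \<Sum>w\<in>S. if length w \<le> b then f w * moment n X (v (b - length w)) (u b) w else 0)"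
    by (rule sum.swap)
  also have "\<dots> = (\<Sum>b<m. \<Sum>j\<le>b. hom_moment n f X (v (b - j)) (u b) j)"
  proof (intro sum.cong refl)
    fix b assume b: "b \<in> {..<m}"
    have "(\<Sum>w\<in>S. if length w \<le> b then f w * moment n X (v (b - length w)) (u b) w else 0)
        = (\<Sum>w\<in>{w \<in> S. length w \<le> b}. f w * moment n X (v (b - length w)) (u b) w)"
      by (rule sum.inter_filter[OF S(1), symmetric])
    also have "{w \<in> S. length w \<le> b} = (\<Union>j\<in>{..b}. {w. length w = j})"
      using S(2) b by auto
    also have "(\<Sum>w\<in>\<dots>. f w * moment n X (v (b - length w)) (u b) w)
        = (\<Sum>j\<le>b. \<Sum>w\<in>{w. length w = j}. f w * moment n X (v (b - length w)) (u b) w)"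
      by (rule sum.UNION_disjoint) (auto simp: finite_words_length)
    also have "\<dots> = (\<Sum>j\<le>b. hom_moment n f X (v (b - j)) (u b) j)"
      unfolding hom_moment_def by (intro sum.cong refl) auto
    finally show "(\<Sum>w\<in>S. if length w \<le> b then f w * moment n X (v (b - length w)) (u b) w else 0)
        = (\<Sum>j\<le>b. hom_moment n f X (v (b - j)) (u b) j)" .
  qed
  finally show ?thesis .
qed

section \<open>Convergence on the matrix convex set\<close>

lemma moment_scale:
  assumes X: "X \<in> mtuples n" and x: "x \<in> carrier_vec n" and y: "y \<in> carrier_vec n"
  shows "moment n (\<lambda>j. c \<cdot>\<^sub>m X j) x y w = c ^ length w * moment n X x y w"
proof -
  have "word_eval n (\<lambda>j. c \<cdot>\<^sub>m X j) w = c ^ length w \<cdot>\<^sub>m word_eval n X w"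
  proof (induction w)
    case Nil thus ?case by (intro eq_matI) auto
  next
    case (Cons j w)
    have Xj: "X j \<in> carrier_mat n n" using X by (simp add: mtuples_def)
    note W = word_eval_carrier[OF X, of w]
    have "(c \<cdot>\<^sub>m X j) * (c ^ length w \<cdot>\<^sub>m word_eval n X w) = c \<cdot>\<^sub>m (X j * (c ^ length w \<cdot>\<^sub>m word_eval n X w))"
      by (rule mult_smult_assoc_mat[OF Xj smult_carrier_mat[OF W]])
    also have "X j * (c ^ length w \<cdot>\<^sub>m word_eval n X w) = c ^ length w \<cdot>\<^sub>m (X j * word_eval n X w)"
      by (rule mult_smult_distrib[OF Xj W])
    also have "c \<cdot>\<^sub>m (c ^ length w \<cdot>\<^sub>m (X j * word_eval n X w)) = c ^ length (j # w) \<cdot>\<^sub>m (X j * word_eval n X w)"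
      by (intro eq_matI) auto
    finally show ?case using Cons by simp
  qed
  thus ?thesis unfolding moment_def by (simp only: smult_form[OF word_eval_carrier[OF X] x y])
qed

lemma hom_moment_scale:
  assumes "X \<in> mtuples n" "x \<in> carrier_vec n" "y \<in> carrier_vec n"
  shows "hom_moment n f (\<lambda>j. c \<cdot>\<^sub>m X j) x y k = c ^ k * hom_moment n f X x y k"
  unfolding hom_moment_def moment_scale[OF assms] sum_distrib_left
  by (intro sum.cong refl) auto

text \<open>
  Room outside \<open>X\<close>: bounds at \<open>(1 + \<delta>) X\<close> become geometric decay of the homogeneous parts at \<open>X\<close>.
\<close>

lemma open_dilation:
  fixes K :: "nat \<Rightarrow> ('d :: finite) mtuple set"
  assumes op: "mc_open K" and n: "1 \<le> n" and X: "X \<in> K n" "X \<in> mtuples n"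
  obtains \<delta> :: real where "0 < \<delta>" "(\<lambda>j. complex_of_real (1 + \<delta>) \<cdot>\<^sub>m X j) \<in> K n"
proof -
  obtain \<epsilon> where \<epsilon>: "0 < \<epsilon>"
    and ball: "\<And>Y. Y \<in> mtuples n \<Longrightarrow> (\<forall>j. mat_norm (Y j - X j) < \<epsilon>) \<Longrightarrow> Y \<in> K n"
    using op n X(1) unfolding mc_open_def by blast
  define B where "B j = (\<Sum>i<n. \<Sum>k<n. cmod (X j $$ (i, k)))" for j
  have B0: "0 \<le> B j" for j unfolding B_def by (intro sum_nonneg) auto
  define C where "C = (\<Sum>j\<in>UNIV. B j) + 1"
  have BC: "B j < C" for j
  proof -
    have "B j \<le> (\<Sum>j\<in>UNIV. B j)" by (rule member_le_sum) (auto simp: B0)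
    thus ?thesis by (simp add: C_def)
  qed
  have C: "0 < C" using BC[of undefined] B0[of undefined] by simp
  define \<delta> where "\<delta> = \<epsilon> / C"
  have \<delta>: "0 < \<delta>" using \<epsilon> C by (simp add: \<delta>_def)
  have Xj: "X j \<in> carrier_mat n n" for j using X by (simp add: mtuples_def)
  let ?Y = "\<lambda>j. complex_of_real (1 + \<delta>) \<cdot>\<^sub>m X j"
  have "mat_norm (?Y j - X j) < \<epsilon>" for j
  proof -
    have D: "?Y j - X j \<in> carrier_mat n n" by (rule minus_carrier_mat[OF Xj])
    have "mat_norm (?Y j - X j) \<le> (\<Sum>i<n. \<Sum>k<n. cmod ((?Y j - X j) $$ (i, k)))"
      by (rule mat_norm_le_sum[OF D])
    also have "\<dots> = (\<Sum>i<n. \<Sum>k<n. \<delta> * cmod (X j $$ (i, k)))"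
    proof (intro sum.cong refl)
      fix i k assume "i \<in> {..<n}" "k \<in> {..<n}"
      hence "(?Y j - X j) $$ (i, k) = complex_of_real \<delta> * X j $$ (i, k)"
        using Xj[of j] by (simp add: algebra_simps)
      thus "cmod ((?Y j - X j) $$ (i, k)) = \<delta> * cmod (X j $$ (i, k))"
        using \<delta> by (simp add: norm_mult)
    qed
    also have "\<dots> = \<delta> * B j" by (simp add: B_def sum_distrib_left)
    also have "\<dots> < \<delta> * C" by (intro mult_strict_left_mono BC \<delta>)
    also have "\<dots> = \<epsilon>" using C by (simp add: \<delta>_def)
    finally show ?thesis .
  qed
  moreover have "?Y \<in> mtuples n" using Xj by (simp add: mtuples_def)
  ultimately have "?Y \<in> K n" using ball by blast
  with \<delta> show ?thesis by (rule that)
qed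

text \<open>
  If the arithmetic means of a convergent sequence lie in the unit disc, so does its limit, since the
  means converge to the same limit.
\<close>

lemma norm_limit_le_of_means:
  fixes s :: "nat \<Rightarrow> complex"
  assumes lim: "s \<longlonglongrightarrow> l" and means: "\<And>m. 1 \<le> m \<Longrightarrow> cmod (\<Sum>b<m. s b) \<le> real m"
  shows "cmod l \<le> 1"
proof (rule field_le_epsilon)
  fix e :: real assume e: "0 < e"
  define e' where "e' = e / 2"
  have e': "0 < e'" using e by (simp add: e'_def)
  obtain N where N: "\<And>b. N \<le> b \<Longrightarrow> cmod (s b - l) < e'"
    using LIMSEQ_D[OF lim e'] by blast
  define D where "D = (\<Sum>b<N. cmod (s b - l))"
  obtain m where m: "D / e' < real m" using reals_Archimedean2 by blast
  define M where "M = Suc (max m N)"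
  have "real m \<le> real M" by (simp add: M_def)
  hence "D / e' < real M" using m by linarith
  hence D: "D \<le> real M * e'" using e' by (simp add: divide_less_eq)
  have "real M * cmod l = cmod (of_nat M * l)" by (simp add: norm_mult)
  also have "of_nat M * l = (\<Sum>b<M. s b) - (\<Sum>b<M. s b - l)" by (simp add: sum_subtractf)
  also have "cmod \<dots> \<le> cmod (\<Sum>b<M. s b) + cmod (\<Sum>b<M. s b - l)" by (rule norm_triangle_ineq4)
  also have "cmod (\<Sum>b<M. s b) \<le> real M" by (rule means) (simp add: M_def)
  also have "cmod (\<Sum>b<M. s b - l) \<le> (\<Sum>b<M. cmod (s b - l))" by (rule norm_sum)
  also have "(\<Sum>b<M. cmod (s b - l)) = D + (\<Sum>b\<in>{N..<M}. cmod (s b - l))"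
  proof -
    have "{..<M} = {..<N} \<union> {N..<M}" by (auto simp: M_def)
    moreover have "{..<N} \<inter> {N..<M} = {}" by auto
    ultimately show ?thesis unfolding D_def by (simp add: sum.union_disjoint)
  qed
  also have "(\<Sum>b\<in>{N..<M}. cmod (s b - l)) \<le> (\<Sum>b\<in>{N..<M}. e')"
    using N by (intro sum_mono) (auto intro: less_imp_le)
  also have "\<dots> \<le> real M * e'" using e' by (simp add: mult_right_mono)
  finally have "real M * cmod l \<le> real M + (D + real M * e')" by simp
  also have "\<dots> \<le> real M * (1 + e)" using D by (simp add: e'_def algebra_simps)
  finally show "cmod l \<le> 1 + e" by (simp add: M_def)
qed

text \<open>
  Each homogeneous part is one block of the Toeplitz matrix, obtained by placing \<open>x\<close> in block \<open>0\<close> and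
  \<open>y\<close> in block \<open>k\<close>.
\<close>

lemma hom_moment_bound:
  fixes K :: "nat \<Rightarrow> ('d :: finite) mtuple set"
  assumes K: "matrix_convex K" and circ: "circled K" and n: "1 \<le> n" and X: "X \<in> K n"
    and f: "\<And>m. \<exists>S. finite S \<and> {w. length w < m} \<subseteq> S \<and> contractive_on K S f"
    and x: "x \<in> carrier_vec n" "l2_norm x \<le> 1" and y: "y \<in> carrier_vec n" "l2_norm y \<le> 1"
  shows "cmod (hom_moment n f X x y k) \<le> 1"
proof -
  note Xt = matrix_convex_mtuples[OF K n X]
  obtain S where S: "finite S" "{w. length w < Suc k} \<subseteq> S" "contractive_on K S f"
    using f by blast
  define v where "v b = (if b = 0 then x else 0\<^sub>v n)" for b :: nat
  define u where "u b = (if b = k then y else 0\<^sub>v n)" for b :: nat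
  have vc: "v b \<in> carrier_vec n" and uc: "u b \<in> carrier_vec n" for b
    using x y by (auto simp: v_def u_def)
  have "(\<Sum>b<Suc k. (l2_norm (v b))\<^sup>2) = (\<Sum>b<Suc k. if b = 0 then (l2_norm x)\<^sup>2 else 0)"
    by (intro sum.cong refl) (simp add: v_def)
  also have "\<dots> \<le> 1" using x by (simp add: power_le_one del: sum.lessThan_Suc)
  finally have vn: "(\<Sum>b<Suc k. (l2_norm (v b))\<^sup>2) \<le> 1" .
  have "(\<Sum>b<Suc k. (l2_norm (u b))\<^sup>2) = (\<Sum>b<Suc k. if b = k then (l2_norm y)\<^sup>2 else 0)"
    by (intro sum.cong refl) (simp add: u_def)
  also have "\<dots> \<le> 1" using y by (simp add: power_le_one del: sum.lessThan_Suc)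
  finally have un: "(\<Sum>b<Suc k. (l2_norm (u b))\<^sup>2) \<le> 1" .
  have zero: "hom_moment n f X a b j = 0" if "a = 0\<^sub>v n \<or> b = 0\<^sub>v n" "a \<in> carrier_vec n" "b \<in> carrier_vec n" for a b j
  proof -
    have "moment n X a b w = 0" for w
      using that word_eval_vec_carrier[OF Xt that(2), of w] mult_mat_zero_vec[OF word_eval_carrier[OF Xt], of w]
      unfolding moment_def by auto
    thus ?thesis by (simp add: hom_moment_def)
  qed
  have "(\<Sum>b<Suc k. \<Sum>j\<le>b. hom_moment n f X (v (b - j)) (u b) j)
      = (\<Sum>b<Suc k. if b = k then hom_moment n f X x y k else 0)"
  proof (intro sum.cong refl)
    fix b assume "b \<in> {..<Suc k}"
    have "hom_moment n f X (v (b - j)) (u b) j = (if j = b then (if b = k then hom_moment n f X x y k else 0) else 0)"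
      if "j \<le> b" for j
    proof (cases "j = b \<and> b = k")
      case True thus ?thesis by (simp add: v_def u_def)
    next
      case False
      hence "v (b - j) = 0\<^sub>v n \<or> u b = 0\<^sub>v n" using that by (auto simp: v_def u_def)
      from zero[OF this vc uc] show ?thesis using False by auto
    qed
    hence "(\<Sum>j\<le>b. hom_moment n f X (v (b - j)) (u b) j)
        = (\<Sum>j\<le>b. if j = b then (if b = k then hom_moment n f X x y k else 0) else 0)"
      by (intro sum.cong refl) simp
    thus "(\<Sum>j\<le>b. hom_moment n f X (v (b - j)) (u b) j) = (if b = k then hom_moment n f X x y k else 0)"
      by simp
  qed
  also have "\<dots> = hom_moment n f X x y k" by (simp del: sum.lessThan_Suc)
  finally have eq: "(\<Sum>b<Suc k. \<Sum>j\<le>b. hom_moment n f X (v (b - j)) (u b) j) = hom_moment n f X x y k" .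
  have "1 \<le> Suc k" by simp
  from toeplitz_contractive[OF K circ n this X S vc vn uc un] show ?thesis unfolding eq .
qed

text \<open>
  Spreading \<open>x\<close> and \<open>y\<close> evenly over the \<open>m\<close> blocks turns the Toeplitz matrix into the Fejer mean of
  the series.
\<close>

lemma hom_moment_means:
  fixes K :: "nat \<Rightarrow> ('d :: finite) mtuple set"
  assumes K: "matrix_convex K" and circ: "circled K" and n: "1 \<le> n" and X: "X \<in> K n"
    and f: "\<And>m. \<exists>S. finite S \<and> {w. length w < m} \<subseteq> S \<and> contractive_on K S f"
    and x: "x \<in> carrier_vec n" "l2_norm x \<le> 1" and y: "y \<in> carrier_vec n" "l2_norm y \<le> 1"
    and m: "1 \<le> m"
  shows "cmod (\<Sum>b<m. \<Sum>j\<le>b. hom_moment n f X x y j) \<le> real m"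
proof -
  note Xt = matrix_convex_mtuples[OF K n X]
  obtain S where S: "finite S" "{w. length w < m} \<subseteq> S" "contractive_on K S f"
    using f by blast
  define c where "c = complex_of_real (1 / sqrt (real m))"
  have cc: "c * cnj c = complex_of_real (1 / real m)"
    using m by (simp add: c_def flip: of_real_mult)
  have cn: "(cmod c)\<^sup>2 = 1 / real m" using m by (simp add: c_def norm_divide power_divide)
  have norm: "(\<Sum>b<m. (l2_norm (c \<cdot>\<^sub>v z))\<^sup>2) \<le> 1" if "l2_norm z \<le> 1" for z
    using m that by (simp add: l2_norm_smult power_mult_distrib cn power_le_one)
  have hom: "hom_moment n f X (c \<cdot>\<^sub>v x) (c \<cdot>\<^sub>v y) j = complex_of_real (1 / real m) * hom_moment n f X x y j" for j
    unfolding hom_moment_def moment_smult[OF Xt x(1) y(1)] cc sum_distrib_left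
    by (intro sum.cong refl) (simp only: mult.left_commute)
  have cx: "c \<cdot>\<^sub>v x \<in> carrier_vec n" "c \<cdot>\<^sub>v y \<in> carrier_vec n" using x y by auto
  have "cmod (\<Sum>b<m. \<Sum>j\<le>b. hom_moment n f X (c \<cdot>\<^sub>v x) (c \<cdot>\<^sub>v y) j) \<le> 1"
    by (rule toeplitz_contractive[OF K circ n m X S, where v = "\<lambda>_. c \<cdot>\<^sub>v x" and u = "\<lambda>_. c \<cdot>\<^sub>v y",
        OF cx(1) norm[OF x(2)] cx(2) norm[OF y(2)]])
  hence "cmod (complex_of_real (1 / real m)) * cmod (\<Sum>b<m. \<Sum>j\<le>b. hom_moment n f X x y j) \<le> 1"
    unfolding hom sum_distrib_left[symmetric] norm_mult .
  moreover have "cmod (complex_of_real (1 / real m)) = 1 / real m" by (simp only: norm_of_real) simp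
  ultimately show ?thesis using m by (simp add: divide_le_eq)
qed

lemma series_partial_form:
  assumes X: "X \<in> mtuples n" and x: "x \<in> carrier_vec n" and y: "y \<in> carrier_vec n"
  shows "(series_partial n f X N *\<^sub>v x) \<bullet>c y = (\<Sum>k<N. hom_moment n f X x y k)"
  unfolding series_partial_def mat_sum_form[OF poly_eval_carrier x y] poly_eval_form[OF X x y] hom_moment_def ..

lemma series_partial_carrier [simp]: "series_partial n f X N \<in> carrier_mat n n"
  by (simp add: series_partial_def)

lemma series_converges_to_iff_entries:
  "series_converges_to n f X L \<longleftrightarrow> L \<in> carrier_mat n n \<and>
    (\<forall>i<n. \<forall>k<n. (\<lambda>N. series_partial n f X N $$ (i, k)) \<longlonglongrightarrow> L $$ (i, k))"
proof (intro iffI conjI allI impI)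
  assume c: "series_converges_to n f X L"
  thus L: "L \<in> carrier_mat n n" by (simp add: series_converges_to_def)
  fix i k assume ik: "i < n" "k < n"
  have D: "series_partial n f X N - L \<in> carrier_mat n n" for N by (rule minus_carrier_mat[OF L])
  have "cmod (series_partial n f X N $$ (i, k) - L $$ (i, k)) \<le> mat_norm (series_partial n f X N - L)" for N
  proof -
    have "(series_partial n f X N - L) $$ (i, k) = series_partial n f X N $$ (i, k) - L $$ (i, k)"
      using L ik by (intro index_minus_mat(1)) auto
    with entry_le_mat_norm[OF D[of N] ik] show ?thesis by (simp only:)
  qed
  hence "\<forall>\<^sub>F N in sequentially. norm (series_partial n f X N $$ (i, k) - L $$ (i, k))
      \<le> mat_norm (series_partial n f X N - L)"
    by (intro always_eventually allI)
  moreover have "(\<lambda>N. mat_norm (series_partial n f X N - L)) \<longlonglongrightarrow> 0"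
    using c unfolding series_converges_to_def by (rule conjunct2)
  ultimately have "(\<lambda>N. series_partial n f X N $$ (i, k) - L $$ (i, k)) \<longlonglongrightarrow> 0"
    by (rule Lim_null_comparison)
  thus "(\<lambda>N. series_partial n f X N $$ (i, k)) \<longlonglongrightarrow> L $$ (i, k)"
    by (rule LIM_zero_cancel)
next
  assume *: "L \<in> carrier_mat n n \<and>
    (\<forall>i<n. \<forall>k<n. (\<lambda>N. series_partial n f X N $$ (i, k)) \<longlonglongrightarrow> L $$ (i, k))"
  hence L: "L \<in> carrier_mat n n" by (rule conjunct1)
  have entries: "(\<lambda>N. series_partial n f X N $$ (i, k)) \<longlonglongrightarrow> L $$ (i, k)" if "i < n" "k < n" for i k
    using conjunct2[OF *] that by blast
  have D: "series_partial n f X N - L \<in> carrier_mat n n" for N by (rule minus_carrier_mat[OF L])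
  have "(\<lambda>N. \<Sum>i<n. \<Sum>k<n. cmod (series_partial n f X N $$ (i, k) - L $$ (i, k))) \<longlonglongrightarrow> 0"
    by (intro tendsto_null_sum tendsto_norm_zero LIM_zero entries) simp_all
  moreover have "norm (mat_norm (series_partial n f X N - L))
      \<le> (\<Sum>i<n. \<Sum>k<n. cmod (series_partial n f X N $$ (i, k) - L $$ (i, k)))" for N
  proof -
    have eq: "(\<Sum>i<n. \<Sum>k<n. cmod ((series_partial n f X N - L) $$ (i, k)))
        = (\<Sum>i<n. \<Sum>k<n. cmod (series_partial n f X N $$ (i, k) - L $$ (i, k)))"
      using L by (intro sum.cong refl arg_cong[of _ _ cmod] index_minus_mat(1)) auto
    show ?thesis
      unfolding real_norm_def abs_of_nonneg[OF mat_norm_nonneg[OF D]]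
      by (rule mat_norm_le_sum[OF D[of N], unfolded eq])
  qed
  ultimately have "(\<lambda>N. mat_norm (series_partial n f X N - L)) \<longlonglongrightarrow> 0"
    by (rule Lim_null_comparison[OF always_eventually[OF allI], rotated])
  thus "series_converges_to n f X L" using L by (simp add: series_converges_to_def)
qed

lemma series_eval_eq:
  assumes c: "series_converges_to n f X L"
  shows "series_eval n f X = L"
  unfolding series_eval_def
proof (rule the_equality, rule c)
  fix M assume M: "series_converges_to n f X M"
  show "M = L"
  proof (rule eq_matI)
    fix i k assume "i < dim_row L" "k < dim_col L"
    hence "i < n" "k < n" using c by (auto simp: series_converges_to_def)
    thus "M $$ (i, k) = L $$ (i, k)"
      using c M unfolding series_converges_to_iff_entries by (blast intro: LIMSEQ_unique)
  qed (use c M in \<open>auto simp: series_converges_to_def\<close>)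
qed

text \<open>
  Geometric decay gives convergence. The partial sums need not be contractions, but their arithmetic
  means are, and these have the same limit.
\<close>

lemma contractive_series_converges:
  fixes K :: "nat \<Rightarrow> ('d :: finite) mtuple set"
  assumes K: "matrix_convex K" and op: "mc_open K" and circ: "circled K"
    and n: "1 \<le> n" and X: "X \<in> K n"
    and f: "\<And>m. \<exists>S. finite S \<and> {w. length w < m} \<subseteq> S \<and> contractive_on K S f"
  obtains L where "series_converges_to n f X L" "mat_norm L \<le> 1"
proof -
  note Xt = matrix_convex_mtuples[OF K n X]
  obtain \<delta> where \<delta>: "0 < \<delta>" and dil: "(\<lambda>j. complex_of_real (1 + \<delta>) \<cdot>\<^sub>m X j) \<in> K n"
    by (rule open_dilation[OF op n X Xt])
  have bound: "cmod (hom_moment n f X x y k) \<le> (1 / (1 + \<delta>)) ^ k"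
    if x: "x \<in> carrier_vec n" "l2_norm x \<le> 1" and y: "y \<in> carrier_vec n" "l2_norm y \<le> 1" for x y k
  proof -
    have "cmod (complex_of_real (1 + \<delta>) ^ k * hom_moment n f X x y k) \<le> 1"
      using hom_moment_bound[OF K circ n dil f x y, of k] unfolding hom_moment_scale[OF Xt x(1) y(1)] .
    hence "(1 + \<delta>) ^ k * cmod (hom_moment n f X x y k) \<le> 1"
      using \<delta> by (simp add: norm_mult norm_power del: of_real_add)
    thus ?thesis using \<delta> by (simp add: power_divide field_simps)
  qed
  have summable: "summable (\<lambda>k. hom_moment n f X x y k)"
    if x: "x \<in> carrier_vec n" "l2_norm x \<le> 1" and y: "y \<in> carrier_vec n" "l2_norm y \<le> 1" for x y
  proof (rule summable_comparison_test)
    show "\<exists>N. \<forall>k\<ge>N. norm (hom_moment n f X x y k) \<le> (1 / (1 + \<delta>)) ^ k" using bound[OF x y] by blast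
    show "summable (\<lambda>k. (1 / (1 + \<delta>)) ^ k)" using \<delta> by (intro summable_geometric) simp
  qed
  define L where "L = mat n n (\<lambda>(i, k). \<Sum>j. hom_moment n f X (unit_vec n k) (unit_vec n i) j)"
  have L: "L \<in> carrier_mat n n" by (simp add: L_def)
  have entries: "(\<lambda>N. series_partial n f X N $$ (i, k)) \<longlonglongrightarrow> L $$ (i, k)" if ik: "i < n" "k < n" for i k
  proof -
    have "series_partial n f X N $$ (i, k) = (\<Sum>j<N. hom_moment n f X (unit_vec n k) (unit_vec n i) j)" for N
      unfolding entry_form[OF series_partial_carrier ik, symmetric]
      by (rule series_partial_form[OF Xt]) auto
    thus ?thesis
      using summable_LIMSEQ[OF summable[of "unit_vec n k" "unit_vec n i"]] ik by (simp add: L_def)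
  qed
  show ?thesis
  proof (rule that[of L])
    show "series_converges_to n f X L"
      unfolding series_converges_to_iff_entries using L entries by blast
    show "mat_norm L \<le> 1"
    proof (rule mat_norm_le[OF L])
      fix x y assume x: "x \<in> carrier_vec n" "l2_norm x \<le> 1" and y: "y \<in> carrier_vec n" "l2_norm y \<le> 1"
      have "(\<lambda>N. (series_partial n f X N *\<^sub>v x) \<bullet>c y) \<longlonglongrightarrow> (L *\<^sub>v x) \<bullet>c y"
        unfolding form_entries[OF series_partial_carrier x(1) y(1)] form_entries[OF L x(1) y(1)]
        by (intro tendsto_sum tendsto_mult tendsto_const entries) auto
      hence "(\<lambda>N. \<Sum>k<N. hom_moment n f X x y k) \<longlonglongrightarrow> (L *\<^sub>v x) \<bullet>c y"
        unfolding series_partial_form[OF Xt x(1) y(1)] .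
      hence "(\<lambda>b. \<Sum>k\<le>b. hom_moment n f X x y k) \<longlonglongrightarrow> (L *\<^sub>v x) \<bullet>c y"
        unfolding lessThan_Suc_atMost[symmetric] by (rule LIMSEQ_Suc)
      thus "cmod ((L *\<^sub>v x) \<bullet>c y) \<le> 1"
        by (rule norm_limit_le_of_means) (rule hom_moment_means[OF K circ n X f x y])
    qed simp
  qed
qed

lemma series_converges_to_nilpotent:
  fixes X :: "('d :: finite) mtuple"
  assumes X: "X \<in> mtuples n" and \<Lambda>: "finite \<Lambda>" and nil: "nilpotent_wrt n \<Lambda> X"
    and f: "\<And>w. w \<in> \<Lambda> \<Longrightarrow> f w = p w"
  shows "series_converges_to n f X (poly_eval n \<Lambda> p X)"
proof -
  obtain M where M: "\<And>w. w \<in> \<Lambda> \<Longrightarrow> length w < M"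
    using finite_imageI[OF \<Lambda>, of length] unfolding finite_nat_iff_bounded by auto
  have "series_partial n f X N $$ (i, k) = poly_eval n \<Lambda> p X $$ (i, k)"
    if N: "M \<le> N" and ik: "i < n" "k < n" for N i k
  proof -
    let ?x = "unit_vec n k :: complex vec" and ?y = "unit_vec n i :: complex vec"
    have zero: "moment n X ?x ?y w = 0" if "w \<notin> \<Lambda>" for w
      using nil that ik by (simp add: nilpotent_wrt_def moment_def zero_mat_mult_vec)
    have "series_partial n f X N $$ (i, k) = (\<Sum>j<N. hom_moment n f X ?x ?y j)"
      unfolding entry_form[OF series_partial_carrier ik, symmetric]
      by (rule series_partial_form[OF X]) auto
    also have "\<dots> = (\<Sum>w\<in>(\<Union>j\<in>{..<N}. {w. length w = j}). f w * moment n X ?x ?y w)"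
      unfolding hom_moment_def
      by (rule sum.UNION_disjoint[symmetric]) (auto simp: finite_words_length)
    also have "\<dots> = (\<Sum>w\<in>\<Lambda>. f w * moment n X ?x ?y w)"
      using M N by (intro sum.mono_neutral_right) (auto simp: finite_words_length zero intro: less_le_trans)
    also have "\<dots> = (\<Sum>w\<in>\<Lambda>. p w * moment n X ?x ?y w)"
      by (intro sum.cong refl) (simp add: f)
    also have "\<dots> = poly_eval n \<Lambda> p X $$ (i, k)"
      unfolding entry_form[OF poly_eval_carrier ik, symmetric]
      by (rule poly_eval_form[OF X, symmetric]) auto
    finally show ?thesis .
  qed
  hence "(\<lambda>N. series_partial n f X N $$ (i, k)) \<longlonglongrightarrow> poly_eval n \<Lambda> p X $$ (i, k)" if "i < n" "k < n" for i k
    using that by (intro tendsto_eventually eventually_sequentiallyI[of M])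
  thus ?thesis unfolding series_converges_to_iff_entries by simp
qed

section \<open>The interpolation theorem\<close>

theorem theorem1:
  fixes K :: "nat \<Rightarrow> ('d::finite) mtuple set"
    and \<Lambda> :: "'d list set"
    and p :: "'d list \<Rightarrow> complex"
  assumes "matrix_convex K"
    and "mc_open K"
    and "mc_bounded K"
    and "circled K"
    and "contains_nc_nbhd_0 K"
    and "finite \<Lambda>"
    and "initial_segment \<Lambda>"
  shows "(\<exists>f\<in>A_infty K. (\<forall>w\<in>\<Lambda>. f w = p w) \<and> series_norm K f \<le> 1) \<longleftrightarrow>
    (SUP (n, X)\<in>{(n, X). (n, X) \<in> points K \<and> nilpotent_wrt n \<Lambda> X}.
       ereal (mat_norm (poly_eval n \<Lambda> p X))) \<le> 1"
proof
  assume "\<exists>f\<in>A_infty K. (\<forall>w\<in>\<Lambda>. f w = p w) \<and> series_norm K f \<le> 1"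
  then obtain f where f: "\<And>w. w \<in> \<Lambda> \<Longrightarrow> f w = p w" and norm: "series_norm K f \<le> 1" by blast
  show "(SUP (n, X)\<in>{(n, X). (n, X) \<in> points K \<and> nilpotent_wrt n \<Lambda> X}.
      ereal (mat_norm (poly_eval n \<Lambda> p X))) \<le> 1"
  proof (rule SUP_least)
    fix z assume "z \<in> {(n, X). (n, X) \<in> points K \<and> nilpotent_wrt n \<Lambda> X}"
    then obtain n X where z: "z = (n, X)" "(n, X) \<in> points K" and nil: "nilpotent_wrt n \<Lambda> X" by auto
    hence "X \<in> mtuples n" using matrix_convex_mtuples[OF assms(1)] by (auto simp: points_def)
    from series_eval_eq[OF series_converges_to_nilpotent[OF this assms(6) nil f]]
    have "ereal (mat_norm (poly_eval n \<Lambda> p X)) = ereal (mat_norm (series_eval n f X))" by simp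
    also have "\<dots> \<le> series_norm K f"
      unfolding series_norm_def by (rule SUP_upper2[OF z(2)]) simp
    also note norm
    finally show "(case z of (n, X) \<Rightarrow> ereal (mat_norm (poly_eval n \<Lambda> p X))) \<le> 1" by (simp add: z(1))
  qed
next
  assume sup: "(SUP (n, X)\<in>{(n, X). (n, X) \<in> points K \<and> nilpotent_wrt n \<Lambda> X}.
      ereal (mat_norm (poly_eval n \<Lambda> p X))) \<le> 1"
  have con: "contractive_on K \<Lambda> p"
    unfolding contractive_on_def
  proof (intro allI ballI impI)
    fix n X x y assume n: "1 \<le> n" and X: "X \<in> K n" and nil: "nilpotent_wrt n \<Lambda> X"
      and x: "x \<in> carrier_vec n" and y: "y \<in> carrier_vec n" and xy: "l2_norm x \<le> 1" "l2_norm y \<le> 1"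
    have "(n, X) \<in> {(n, X). (n, X) \<in> points K \<and> nilpotent_wrt n \<Lambda> X}"
      using n X nil by (simp add: points_def)
    hence "ereal (mat_norm (poly_eval n \<Lambda> p X)) \<le> (SUP (n, X)\<in>{(n, X). (n, X) \<in> points K \<and> nilpotent_wrt n \<Lambda> X}.
      ereal (mat_norm (poly_eval n \<Lambda> p X)))"
      by (rule SUP_upper2) simp
    hence "ereal (mat_norm (poly_eval n \<Lambda> p X)) \<le> 1" using sup by (rule order_trans)
    hence "mat_norm (poly_eval n \<Lambda> p X) \<le> 1" by simp
    thus "cmod (\<Sum>w\<in>\<Lambda>. p w * moment n X x y w) \<le> 1"
      using form_le_mat_norm[OF poly_eval_carrier x xy(1) y xy(2), of \<Lambda> p X]
      unfolding poly_eval_form[OF matrix_convex_mtuples[OF assms(1) n X] x y] by simp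
  qed
  obtain f where fp: "\<And>w. w \<in> \<Lambda> \<Longrightarrow> f w = p w"
    and f: "\<And>m. \<exists>S. finite S \<and> {w. length w < m} \<subseteq> S \<and> contractive_on K S f"
    by (rule contractive_extension[OF assms(1,6,7) con]) (rule that)
  have ex: "\<exists>L. series_converges_to n f X L \<and> mat_norm L \<le> 1" if "(n, X) \<in> points K" for n X
  proof -
    have "1 \<le> n" "X \<in> K n" using that by (simp_all add: points_def)
    then obtain L where "series_converges_to n f X L" "mat_norm L \<le> 1"
      by (rule contractive_series_converges[OF assms(1,2,4) _ _ f])
    thus ?thesis by blast
  qed
  have "series_norm K f \<le> 1"
    unfolding series_norm_def
  proof (rule SUP_least)
    fix z assume z: "z \<in> points K"
    obtain n X where zeq: "z = (n, X)" by (cases z)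
    obtain L where "series_converges_to n f X L" "mat_norm L \<le> 1" using ex z zeq by blast
    thus "(case z of (n, X) \<Rightarrow> ereal (mat_norm (series_eval n f X))) \<le> 1"
      by (simp add: zeq series_eval_eq)
  qed
  moreover have "f \<in> A_infty K"
    unfolding A_infty_def mem_Collect_eq
  proof
    show "\<forall>(n, X)\<in>points K. \<exists>L. series_converges_to n f X L" using ex by blast
    show "series_norm K f < \<infinity>"
      using \<open>series_norm K f \<le> 1\<close> by (rule order_le_less_trans) simp
  qed
  ultimately show "\<exists>f\<in>A_infty K. (\<forall>w\<in>\<Lambda>. f w = p w) \<and> series_norm K f \<le> 1"
    using fp by blast
qed

end
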